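(* Let $A$ be a finite set with $|A| \ge 2$. There exists a constant $C = C(|A|)$ such that the following holds. Let $n \ge 3$ and let $f : A^n \to A$ be symmetric and monotone. Then for every $a \in A$ and every $\varepsilon \in (0,1/2)$, \[ \gamma\big[\mu \in \Delta[A] : \varepsilon \le \mathbb{P}_{\mu}[f = a] \le 1-\varepsilon\big] \le C\,\big(\log(1-\varepsilon) - \log(\varepsilon)\big)\,\frac{\log \log n}{\log n}. \]
   Context: For $x \in A^n$ and a permutation $\sigma$ of $\{1,\dots,n\}$, $x_\sigma$ denotes the vector with $(x_\sigma)_i = x_{\sigma(i)}$. For $a \in A$ and $x,y \in A^n$, write $x \le_a y$ if $\{i : x_i = a\} \subseteq \{i : y_i = a\}$ and $x_i = y_i$ for every $i$ with $y_i \neq a$ (i.e. $y$ is obtained from $x$ by changing some coordinates to $a$). A function $f : A^n \to A$ is monotone if for all $a \in A$ and all $x \le_a y$, $f(x) = a$ implies $f(y) = a$. It is symmetric if there is a transitive subgroup $\Sigma$ of the symmetric group on $\{1,\dots,n\}$ with $f(x_\sigma) = f(x)$ for all $x$ and all $\sigma \in \Sigma$. $\Delta[A]$ is the simplex of probability measures on $A$, and $\gamma$ is the standard (normalized Lebesgue, i.e. uniform) probability measure on $\Delta[A]$. For $\mu \in \Delta[A]$, $\mathbb{P}_\mu$ is the product measure $\mu^{\otimes n}$ on $A^n$. *)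

theory Defs
  imports "HOL-Probability.Probability" "HOL-Algebra.Sym_Groups"
begin

text \<open>
  The cube \<open>A\<^sup>n\<close> is the set of extensional functions \<open>{1..n} \<rightarrow>\<^sub>E A\<close>, and the symmetric group
  on \<open>{1,\<dots>,n}\<close> is \<^const>\<open>sym_group\<close>. Its elements fix every point outside \<open>{1..n}\<close>, so
  \<open>x \<circ> \<sigma>\<close> is again extensional and is the vector \<open>x\<^sub>\<sigma>\<close> with coordinates \<open>x (\<sigma> i)\<close>.
\<close>

abbreviation cube :: "'a set \<Rightarrow> nat \<Rightarrow> (nat \<Rightarrow> 'a) set" where
  "cube A n \<equiv> {1..n} \<rightarrow>\<^sub>E A"

definition le_at :: "nat \<Rightarrow> 'a \<Rightarrow> (nat \<Rightarrow> 'a) \<Rightarrow> (nat \<Rightarrow> 'a) \<Rightarrow> bool" where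
  "le_at n a x y \<longleftrightarrow>
     {i \<in> {1..n}. x i = a} \<subseteq> {i \<in> {1..n}. y i = a} \<and>
     (\<forall>i\<in>{1..n}. y i \<noteq> a \<longrightarrow> x i = y i)"

definition monotone_rule :: "'a set \<Rightarrow> nat \<Rightarrow> ((nat \<Rightarrow> 'a) \<Rightarrow> 'a) \<Rightarrow> bool" where
  "monotone_rule A n f \<longleftrightarrow>
     (\<forall>a\<in>A. \<forall>x\<in>cube A n. \<forall>y\<in>cube A n. le_at n a x y \<longrightarrow> f x = a \<longrightarrow> f y = a)"

definition transitive_perms :: "nat \<Rightarrow> (nat \<Rightarrow> nat) set \<Rightarrow> bool" where
  "transitive_perms n S \<longleftrightarrow> (\<forall>i\<in>{1..n}. \<forall>j\<in>{1..n}. \<exists>\<sigma>\<in>S. \<sigma> i = j)"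

definition symmetric_rule :: "'a set \<Rightarrow> nat \<Rightarrow> ((nat \<Rightarrow> 'a) \<Rightarrow> 'a) \<Rightarrow> bool" where
  "symmetric_rule A n f \<longleftrightarrow>
     (\<exists>S. subgroup S (sym_group n) \<and> transitive_perms n S \<and>
          (\<forall>x\<in>cube A n. \<forall>\<sigma>\<in>S. f (x \<circ> \<sigma>) = f x))"

text \<open>Probability measures on the finite set \<open>A\<close>, given by their point masses.\<close>

definition prob_simplex :: "'a set \<Rightarrow> ('a \<Rightarrow> real) set" where
  "prob_simplex A = {\<mu> \<in> A \<rightarrow>\<^sub>E UNIV. (\<forall>a\<in>A. 0 \<le> \<mu> a) \<and> sum \<mu> A = 1}"

text \<open>
  The normalized Lebesgue measure on the simplex. Forgetting the coordinate at a point \<open>b\<close> of \<open>A\<close>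
  is an affine chart from the hyperplane of total mass \<open>1\<close> onto the functions on \<open>A - {b}\<close>; it maps
  the simplex onto the corner below. The measure is the image of the uniform distribution on this
  corner under the inverse of the chart. It does not depend on \<open>b\<close>: the transition map between two
  such charts is affine with determinant \<open>-1\<close>.
\<close>

definition simplex_corner :: "'a set \<Rightarrow> 'a \<Rightarrow> ('a \<Rightarrow> real) set" where
  "simplex_corner A b =
     {t \<in> A - {b} \<rightarrow>\<^sub>E UNIV. (\<forall>c\<in>A - {b}. 0 \<le> t c) \<and> sum t (A - {b}) \<le> 1}"

definition simplex_chart_inv :: "'a set \<Rightarrow> 'a \<Rightarrow> ('a \<Rightarrow> real) \<Rightarrow> ('a \<Rightarrow> real)" where
  "simplex_chart_inv A b t = t(b := 1 - sum t (A - {b}))"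

definition simplex_measure :: "'a set \<Rightarrow> ('a \<Rightarrow> real) measure" where
  "simplex_measure A =
     (let b = (SOME b. b \<in> A) in
      restrict_space
        (distr (uniform_measure (\<Pi>\<^sub>M c\<in>A - {b}. lborel) (simplex_corner A b))
               (\<Pi>\<^sub>M c\<in>A. borel)
               (simplex_chart_inv A b))
        (prob_simplex A))"

text \<open>The product measure \<open>\<mu>\<^sup>\<otimes>\<^sup>n\<close> on \<open>A\<^sup>n\<close>.\<close>

definition product_law :: "'a set \<Rightarrow> nat \<Rightarrow> ('a \<Rightarrow> real) \<Rightarrow> (nat \<Rightarrow> 'a) measure" where
  "product_law A n \<mu> = (\<Pi>\<^sub>M i\<in>{1..n}. point_measure A (\<lambda>a. ennreal (\<mu> a)))"

end

theory Submission
  imports Defs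
begin

text \<open>
  Let \<open>P(\<mu>)\<close> be the probability of \<open>f = a\<close>. For every \<open>\<mu>\<close>, however small its atoms,
  the entropy of \<open>g\<^sup>2\<close> on \<open>A\<close> is at most \<open>9 \<Sum>\<^sub>b (g(a) - g(b))\<^sup>2\<close>. This inequality tensorizes, and
  the argument of Falik and Samorodnitsky turns it into a bound of KKL type: for a symmetric rule the
  derivatives of \<open>P\<close> in the directions \<open>e\<^sub>a - e\<^sub>b\<close>, all nonnegative by monotonicity, add up to at
  least \<open>P (1 - P) ln n / 18\<close>. On a line in one of these directions, the integral of the derivative
  divided by \<open>P (1 - P)\<close> over the window \<open>\<epsilon> \<le> P \<le> 1 - \<epsilon>\<close> is a difference of two logits, at most
  \<open>2 (ln (1 - \<epsilon>) - ln \<epsilon>)\<close>. Integrating over all such lines and summing over \<open>b\<close> bounds the volume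
  of the window by a multiple of \<open>(ln (1 - \<epsilon>) - ln \<epsilon>) / ln n\<close>, which is even stronger than required.
\<close>

section \<open>Product expectations\<close>

text \<open>The weights are arbitrary reals. For finite \<open>A\<close> and \<open>I\<close> the
  expectation is thus a polynomial in the weights that makes sense off the simplex and can be
  differentiated along whole lines.\<close>

definition prod_expect :: "'a set \<Rightarrow> ('a \<Rightarrow> real) \<Rightarrow> 'i set \<Rightarrow> (('i \<Rightarrow> 'a) \<Rightarrow> real) \<Rightarrow> real" where
  "prod_expect A \<mu> I f = (\<Sum>x\<in>I \<rightarrow>\<^sub>E A. (\<Prod>i\<in>I. \<mu> (x i)) * f x)"

text \<open>The discrete derivative is anchored at one letter \<open>a\<close>, not taken between
  all pairs of letters; for the indicator of outcome \<open>a\<close> under a monotone rule this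
  makes it nonnegative.\<close>

definition discr :: "'a \<Rightarrow> 'i \<Rightarrow> 'a \<Rightarrow> (('i \<Rightarrow> 'a) \<Rightarrow> real) \<Rightarrow> ('i \<Rightarrow> 'a) \<Rightarrow> real" where
  "discr a i b f x = f (x(i := a)) - f (x(i := b))"

lemma prod_expect_empty [simp]: "prod_expect A \<mu> {} f = f (\<lambda>_. undefined)"
  by (simp add: prod_expect_def)

lemma prod_expect_cong:
  "(\<And>x. x \<in> I \<rightarrow>\<^sub>E A \<Longrightarrow> f x = g x) \<Longrightarrow> prod_expect A \<mu> I f = prod_expect A \<mu> I g"
  by (simp add: prod_expect_def)

lemma prod_expect_add:
  "prod_expect A \<mu> I (\<lambda>x. f x + g x) = prod_expect A \<mu> I f + prod_expect A \<mu> I g"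
  by (simp add: prod_expect_def distrib_left sum.distrib)

lemma prod_expect_diff:
  "prod_expect A \<mu> I (\<lambda>x. f x - g x) = prod_expect A \<mu> I f - prod_expect A \<mu> I g"
  by (simp add: prod_expect_def right_diff_distrib sum_subtractf)

lemma prod_expect_cmult:
  "prod_expect A \<mu> I (\<lambda>x. c * f x) = c * prod_expect A \<mu> I f"
  unfolding prod_expect_def sum_distrib_left by (intro sum.cong refl mult.left_commute)

lemma prod_expect_multc:
  "prod_expect A \<mu> I (\<lambda>x. f x * c) = prod_expect A \<mu> I f * c"
  unfolding prod_expect_def sum_distrib_right by (intro sum.cong refl mult.assoc[symmetric])

lemma prod_expect_sum:
  "prod_expect A \<mu> I (\<lambda>x. \<Sum>b\<in>B. f b x) = (\<Sum>b\<in>B. prod_expect A \<mu> I (f b))"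
  unfolding prod_expect_def sum_distrib_left by (rule sum.swap)

text \<open>Fubini for a single coordinate. Tensorization and the derivative formula both run by
  induction on \<open>I\<close> through this identity.\<close>

lemma prod_expect_insert:
  assumes "finite I" "i \<notin> I"
  shows "prod_expect A \<mu> (insert i I) f = (\<Sum>b\<in>A. \<mu> b * prod_expect A \<mu> I (\<lambda>x. f (x(i := b))))"
proof -
  have "prod_expect A \<mu> (insert i I) f =
      (\<Sum>(b, x)\<in>A \<times> (I \<rightarrow>\<^sub>E A). (\<Prod>j\<in>insert i I. \<mu> ((x(i := b)) j)) * f (x(i := b)))"
    unfolding prod_expect_def PiE_insert_eq
    by (subst sum.reindex[OF inj_combinator[OF assms(2)]]) (simp add: case_prod_beta)
  also have "\<dots> = (\<Sum>(b, x)\<in>A \<times> (I \<rightarrow>\<^sub>E A). \<mu> b * ((\<Prod>j\<in>I. \<mu> (x j)) * f (x(i := b))))"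
  proof (intro sum.cong refl, clarify)
    fix b x
    have "(\<Prod>j\<in>insert i I. \<mu> ((x(i := b)) j)) = \<mu> b * (\<Prod>j\<in>I. \<mu> ((x(i := b)) j))"
      using assms by (subst prod.insert) auto
    also have "(\<Prod>j\<in>I. \<mu> ((x(i := b)) j)) = (\<Prod>j\<in>I. \<mu> (x j))"
      using assms by (intro prod.cong) auto
    finally show "(\<Prod>j\<in>insert i I. \<mu> ((x(i := b)) j)) * f (x(i := b)) =
       \<mu> b * ((\<Prod>j\<in>I. \<mu> (x j)) * f (x(i := b)))" by simp
  qed
  also have "\<dots> = (\<Sum>b\<in>A. \<mu> b * prod_expect A \<mu> I (\<lambda>x. f (x(i := b))))"
    by (simp add: prod_expect_def sum.cartesian_product[symmetric] sum_distrib_left)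
  finally show ?thesis .
qed

lemma prod_expect_insert':
  assumes "finite I" "i \<notin> I"
  shows "prod_expect A \<mu> (insert i I) f = prod_expect A \<mu> I (\<lambda>x. \<Sum>b\<in>A. \<mu> b * f (x(i := b)))"
  by (simp add: prod_expect_insert[OF assms] prod_expect_sum prod_expect_cmult)

lemma prod_expect_insert_const:
  assumes "finite I" "i \<notin> I" "sum \<mu> A = 1" "\<And>x b. f (x(i := b)) = f x"
  shows "prod_expect A \<mu> (insert i I) f = prod_expect A \<mu> I f"
  using assms(3) by (simp add: prod_expect_insert[OF assms(1,2)] assms(4) flip: sum_distrib_right)

lemma discr_upd [simp]: "discr a i b f (x(i := c)) = discr a i b f x"
  by (simp add: discr_def)

lemma discr_upd_commute:
  assumes "i \<noteq> j"
  shows "discr a j c (\<lambda>x. f (x(i := b))) x = discr a j c f (x(i := b))"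
  using assms by (simp add: discr_def fun_upd_twist)

section \<open>Logarithmic Sobolev inequality\<close>

text \<open>Convexity of \<open>s * ln s\<close>: the right-hand side is its tangent line at
  \<open>t\<close>.\<close>

lemma mult_ln_le_tangent:
  fixes s t :: real
  assumes "0 \<le> s" "0 < t"
  shows "s * ln s \<ge> s * ln t + s - t"
proof (cases "s = 0")
  case False
  then have "s > 0" using assms by simp
  have "ln (t / s) \<le> t / s - 1"
    using \<open>s > 0\<close> assms by (intro ln_le_minus_one) simp
  then have "s * ln (t / s) \<le> s * (t / s - 1)"
    using \<open>s > 0\<close> by (intro mult_left_mono) auto
  then show ?thesis
    using \<open>s > 0\<close> assms by (simp add: ln_div algebra_simps)
qed (use assms in simp)

text \<open>The gap between \<open>s * ln s\<close> and its tangent at \<open>t\<close> is at most a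
  chi-square term, by \<open>ln u \<le> u - 1\<close> at \<open>u = s / t\<close>.\<close>

lemma mult_ln_le_sq:
  fixes s t :: real
  assumes "0 \<le> s" "0 < t"
  shows "s * ln s - s * ln t - s + t \<le> (s - t)\<^sup>2 / t"
proof (cases "s = 0")
  case False
  then have "s > 0" using assms by simp
  have "ln (s / t) \<le> s / t - 1"
    using \<open>s > 0\<close> assms by (intro ln_le_minus_one) simp
  then have "s * ln (s / t) \<le> s * (s / t - 1)"
    using \<open>s > 0\<close> by (intro mult_left_mono) auto
  then have "s * ln s - s * ln t - s + t \<le> s * (s / t - 1) - s + t"
    using \<open>s > 0\<close> assms by (simp add: ln_div algebra_simps)
  also have "\<dots> = (s - t)\<^sup>2 / t"
    using assms by (simp add: field_simps power2_eq_square)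
  finally show ?thesis .
qed (use assms in \<open>simp add: power2_eq_square\<close>)

locale fin_dist =
  fixes A :: "'a set" and \<mu> :: "'a \<Rightarrow> real"
  assumes fin: "finite A" and nonneg: "\<And>b. b \<in> A \<Longrightarrow> 0 \<le> \<mu> b" and total: "sum \<mu> A = 1"
begin

abbreviation E :: "'i set \<Rightarrow> (('i \<Rightarrow> 'a) \<Rightarrow> real) \<Rightarrow> real" where
  "E \<equiv> prod_expect A \<mu>"

lemma weight_nonneg: "x \<in> I \<rightarrow>\<^sub>E A \<Longrightarrow> 0 \<le> (\<Prod>i\<in>I. \<mu> (x i))"
  by (auto intro!: prod_nonneg nonneg)

lemma E_mono:
  assumes "\<And>x. x \<in> I \<rightarrow>\<^sub>E A \<Longrightarrow> f x \<le> g x"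
  shows "E I f \<le> E I g"
  unfolding prod_expect_def by (intro sum_mono mult_left_mono assms weight_nonneg)

lemma E_nonneg:
  assumes "\<And>x. x \<in> I \<rightarrow>\<^sub>E A \<Longrightarrow> 0 \<le> f x"
  shows "0 \<le> E I f"
  unfolding prod_expect_def by (intro sum_nonneg mult_nonneg_nonneg assms weight_nonneg)

text \<open>The reverse triangle inequality in the weighted L2 norm. Tensorization uses it to
  compare the norms of two sections of a function with the norm of their difference.\<close>

lemma sqrt_E_diff_sq_le:
  "(sqrt (E I (\<lambda>x. (f x)\<^sup>2)) - sqrt (E I (\<lambda>x. (g x)\<^sup>2)))\<^sup>2 \<le> E I (\<lambda>x. (f x - g x)\<^sup>2)"
proof -
  define w where "w x = sqrt (\<Prod>i\<in>I. \<mu> (x i))" for x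
  have L2: "sqrt (E I (\<lambda>x. (h x)\<^sup>2)) = L2_set (\<lambda>x. w x * h x) (I \<rightarrow>\<^sub>E A)" for h
    unfolding prod_expect_def L2_set_def
    by (intro arg_cong[of _ _ sqrt] sum.cong refl) (simp add: w_def power_mult_distrib weight_nonneg)
  have tri: "L2_set (\<lambda>x. w x * u x) (I \<rightarrow>\<^sub>E A) \<le>
     L2_set (\<lambda>x. w x * v x) (I \<rightarrow>\<^sub>E A) + L2_set (\<lambda>x. w x * (u x - v x)) (I \<rightarrow>\<^sub>E A)" for u v
    using L2_set_triangle_ineq[of "\<lambda>x. w x * v x" "\<lambda>x. w x * (u x - v x)" "I \<rightarrow>\<^sub>E A"]
    by (simp add: algebra_simps)
  have sym: "L2_set (\<lambda>x. w x * (g x - f x)) (I \<rightarrow>\<^sub>E A) = L2_set (\<lambda>x. w x * (f x - g x)) (I \<rightarrow>\<^sub>E A)"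
    unfolding L2[symmetric] by (simp add: power2_commute)
  have "\<bar>sqrt (E I (\<lambda>x. (f x)\<^sup>2)) - sqrt (E I (\<lambda>x. (g x)\<^sup>2))\<bar> \<le> sqrt (E I (\<lambda>x. (f x - g x)\<^sup>2))"
    using tri[of f g] tri[of g f] sym unfolding L2 by linarith
  then have "\<bar>sqrt (E I (\<lambda>x. (f x)\<^sup>2)) - sqrt (E I (\<lambda>x. (g x)\<^sup>2))\<bar>\<^sup>2 \<le> (sqrt (E I (\<lambda>x. (f x - g x)\<^sup>2)))\<^sup>2"
    by (rule power_mono) simp
  then show ?thesis
    by (simp add: E_nonneg)
qed

definition ent :: "'i set \<Rightarrow> (('i \<Rightarrow> 'a) \<Rightarrow> real) \<Rightarrow> real" where
  "ent I h = E I (\<lambda>x. h x * ln (h x)) - E I h * ln (E I h)"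

text \<open>The sum over letters \<open>b\<close> carries no weight \<open>\<mu> b\<close>. This
  larger form admits a log-Sobolev constant that does not depend on \<open>\<mu>\<close>.\<close>

definition energy :: "'a \<Rightarrow> 'i set \<Rightarrow> (('i \<Rightarrow> 'a) \<Rightarrow> real) \<Rightarrow> real" where
  "energy a I f = (\<Sum>i\<in>I. \<Sum>b\<in>A. E I (\<lambda>x. (discr a i b f x)\<^sup>2))"

text \<open>The centre \<open>t\<close> of the tangent line is \<open>g(a)\<^sup>2\<close> or the energy, whichever is larger; this
  keeps the constant independent of the smallest atom of \<open>\<mu>\<close>.\<close>

lemma log_sobolev_one_point:
  fixes g :: "'a \<Rightarrow> real"
  assumes a: "a \<in> A"
  defines "m \<equiv> (\<Sum>b\<in>A. \<mu> b * (g b)\<^sup>2)"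
  shows "(\<Sum>b\<in>A. \<mu> b * ((g b)\<^sup>2 * ln ((g b)\<^sup>2))) - m * ln m \<le> 9 * (\<Sum>b\<in>A. (g a - g b)\<^sup>2)"
proof -
  define U where "U = (\<Sum>b\<in>A. (g a - g b)\<^sup>2)"
  define t where "t = max ((g a)\<^sup>2) U"
  have U0: "U \<ge> 0" unfolding U_def by (intro sum_nonneg) auto
  have dU: "(g a - g b)\<^sup>2 \<le> U" if "b \<in> A" for b
    unfolding U_def using that fin by (intro member_le_sum[where f = "\<lambda>b. (g a - g b)\<^sup>2"]) auto
  have m0: "0 \<le> m" unfolding m_def by (intro sum_nonneg mult_nonneg_nonneg nonneg) auto
  show ?thesis
  proof (cases "t = 0")
    case True
    then have "g b = 0" if "b \<in> A" for b
      using dU[OF that] U0 unfolding t_def by (auto simp: max_def split: if_splits)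
    then show ?thesis by (simp add: m_def)
  next
    case False
    then have t: "t > 0" using U0 unfolding t_def by (smt (verit) zero_le_power2)
    \<comment> \<open>If \<open>t = (g a)\<^sup>2\<close>, then \<open>\<bar>g a + g b\<bar>\<close>
      is at most \<open>3 * \<bar>g a\<bar>\<close>; if \<open>t = U\<close>, then
      \<open>(g b)\<^sup>2\<close> lies between 0 and \<open>4 * U\<close> and differs from
      \<open>U\<close> by at most \<open>3 * U\<close>. Both cases give the factor 9.\<close>
    have pt: "((g b)\<^sup>2 - t)\<^sup>2 / t \<le> 9 * U" if "b \<in> A" for b
    proof (cases "U \<le> (g a)\<^sup>2")
      case True
      then have tt: "t = (g a)\<^sup>2" by (simp add: t_def max_def)
      have "\<bar>g a - g b\<bar> \<le> \<bar>g a\<bar>"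
        using dU[OF that] True by (meson abs_le_square_iff order_trans)
      then have "\<bar>g a + g b\<bar> \<le> 3 * \<bar>g a\<bar>" by linarith
      then have "(g a + g b)\<^sup>2 \<le> 9 * (g a)\<^sup>2"
        using power_mono[of "\<bar>g a + g b\<bar>" "3 * \<bar>g a\<bar>" 2] by (simp add: power_mult_distrib)
      then have "(g a + g b)\<^sup>2 * (g a - g b)\<^sup>2 \<le> (9 * (g a)\<^sup>2) * U"
        using dU[OF that] by (intro mult_mono) auto
      moreover have "((g b)\<^sup>2 - t)\<^sup>2 = (g a + g b)\<^sup>2 * (g a - g b)\<^sup>2"
        unfolding tt by (simp add: power2_eq_square algebra_simps)
      ultimately show ?thesis using t unfolding tt by (simp add: divide_le_eq mult_ac)
    next
      case False
      then have tt: "t = U" by (simp add: t_def max_def)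
      have "\<bar>g a\<bar> \<le> sqrt U" "\<bar>g a - g b\<bar> \<le> sqrt U"
        using False dU[OF that] by (auto intro!: real_le_rsqrt)
      then have "\<bar>g b\<bar> \<le> 2 * sqrt U" by linarith
      then have "(g b)\<^sup>2 \<le> 4 * U"
        using power_mono[of "\<bar>g b\<bar>" "2 * sqrt U" 2] U0 by (simp add: power_mult_distrib)
      then have "\<bar>(g b)\<^sup>2 - U\<bar> \<le> 3 * U" using U0 by (smt (verit) zero_le_power2)
      then have "((g b)\<^sup>2 - U)\<^sup>2 \<le> 9 * U * U"
        using power_mono[of "\<bar>(g b)\<^sup>2 - U\<bar>" "3 * U" 2] by (simp add: power2_eq_square)
      then show ?thesis using t unfolding tt by (simp add: divide_le_eq mult_ac)
    qed
    \<comment> \<open>Replacing \<open>m * ln m\<close> by its tangent at \<open>t\<close> bounds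
      the entropy by an average of pointwise tangent gaps.\<close>
    have "(\<Sum>b\<in>A. \<mu> b * ((g b)\<^sup>2 * ln ((g b)\<^sup>2))) - m * ln m
        \<le> (\<Sum>b\<in>A. \<mu> b * ((g b)\<^sup>2 * ln ((g b)\<^sup>2))) - (m * ln t + m - t)"
      using mult_ln_le_tangent[OF m0 t] by linarith
    also have "\<dots> = (\<Sum>b\<in>A. \<mu> b * ((g b)\<^sup>2 * ln ((g b)\<^sup>2) - (g b)\<^sup>2 * ln t - (g b)\<^sup>2 + t))"
      using total by (simp add: m_def algebra_simps sum.distrib sum_subtractf flip: sum_distrib_left sum_distrib_right)
    also have "\<dots> \<le> (\<Sum>b\<in>A. \<mu> b * (9 * U))"
      using mult_ln_le_sq[OF zero_le_power2 t] pt
      by (intro sum_mono mult_left_mono nonneg) (meson order_trans)+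
    also have "\<dots> = 9 * U" using total by (simp flip: sum_distrib_right)
    finally show ?thesis unfolding U_def .
  qed
qed

text \<open>The derivative in the new coordinate does not depend on that coordinate, so its
  expectation reduces to one over \<open>I\<close>.\<close>

lemma energy_insert:
  assumes "finite I" "i \<notin> I"
  shows "energy a (insert i I) f = (\<Sum>b\<in>A. \<mu> b * energy a I (\<lambda>x. f (x(i := b)))) +
           (\<Sum>b\<in>A. E I (\<lambda>x. (f (x(i := a)) - f (x(i := b)))\<^sup>2))"
proof -
  have 1: "E (insert i I) (\<lambda>x. (discr a i b f x)\<^sup>2) = E I (\<lambda>x. (f (x(i := a)) - f (x(i := b)))\<^sup>2)" for b
    using assms total by (subst prod_expect_insert_const) (simp_all add: discr_def)
  have 2: "(\<Sum>b\<in>A. \<mu> b * energy a I (\<lambda>x. f (x(i := b)))) =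
     (\<Sum>j\<in>I. \<Sum>c\<in>A. E (insert i I) (\<lambda>x. (discr a j c f x)\<^sup>2))"
  proof -
    have "(\<Sum>b\<in>A. \<mu> b * energy a I (\<lambda>x. f (x(i := b)))) =
       (\<Sum>b\<in>A. \<Sum>j\<in>I. \<Sum>c\<in>A. \<mu> b * E I (\<lambda>x. (discr a j c f (x(i := b)))\<^sup>2))"
      unfolding energy_def sum_distrib_left
      by (intro sum.cong refl arg_cong2[where f = "(*)"] prod_expect_cong)
        (use assms in \<open>metis discr_upd_commute\<close>)
    also have "\<dots> = (\<Sum>j\<in>I. \<Sum>c\<in>A. \<Sum>b\<in>A. \<mu> b * E I (\<lambda>x. (discr a j c f (x(i := b)))\<^sup>2))"
      by (subst sum.swap) (intro sum.cong refl sum.swap)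
    finally show ?thesis by (simp add: prod_expect_insert[OF assms])
  qed
  show ?thesis
    unfolding 2 using assms by (simp add: energy_def 1)
qed

text \<open>Tensorization by induction on \<open>I\<close>. The one-point inequality is applied to
  the L2 norms \<open>G b\<close> of the sections, whose increments are controlled by the energy in
  the new coordinate.\<close>

lemma log_sobolev:
  assumes "finite I" and a: "a \<in> A"
  shows "ent I (\<lambda>x. (f x)\<^sup>2) \<le> 9 * energy a I f"
  using assms(1)
proof (induction I arbitrary: f rule: finite_induct)
  case empty
  then show ?case by (simp add: ent_def energy_def)
next
  case (insert i I)
  define F where "F b x = f (x(i := b))" for b x
  define G where "G b = sqrt (E I (\<lambda>x. (F b x)\<^sup>2))" for b
  have G2: "(G b)\<^sup>2 = E I (\<lambda>x. (F b x)\<^sup>2)" for b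
    unfolding G_def by (simp add: E_nonneg)
  \<comment> \<open>Chain rule of entropy: the mean of the entropies of the sections plus the
    entropy of their means \<open>(G b)\<^sup>2\<close>.\<close>
  have "ent (insert i I) (\<lambda>x. (f x)\<^sup>2) =
      (\<Sum>b\<in>A. \<mu> b * ent I (\<lambda>x. (F b x)\<^sup>2)) +
      ((\<Sum>b\<in>A. \<mu> b * ((G b)\<^sup>2 * ln ((G b)\<^sup>2))) - (\<Sum>b\<in>A. \<mu> b * (G b)\<^sup>2) * ln (\<Sum>b\<in>A. \<mu> b * (G b)\<^sup>2))"
    by (simp add: ent_def prod_expect_insert[OF insert.hyps] G2 F_def sum_subtractf algebra_simps)
  also have "\<dots> \<le> (\<Sum>b\<in>A. \<mu> b * (9 * energy a I (F b))) + 9 * (\<Sum>b\<in>A. (G a - G b)\<^sup>2)"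
    by (intro add_mono sum_mono mult_left_mono insert.IH nonneg log_sobolev_one_point a)
  also have "\<dots> \<le> (\<Sum>b\<in>A. \<mu> b * (9 * energy a I (F b))) + 9 * (\<Sum>b\<in>A. E I (\<lambda>x. (F a x - F b x)\<^sup>2))"
    unfolding G_def by (intro add_mono sum_mono mult_left_mono sqrt_E_diff_sq_le order_refl) auto
  also have "\<dots> = 9 * energy a (insert i I) f"
    unfolding energy_insert[OF insert.hyps] F_def
    by (simp add: sum_distrib_left algebra_simps)
  finally show ?case .
qed

text \<open>A small L1 norm relative to the L2 norm forces a large entropy. With \<open>v\<close>
  the second moment, convexity bounds the mean of \<open>d\<^sup>2 * ln (d\<^sup>2)\<close> below by
  \<open>2 * v * ln (v / M)\<close>; the tangent of \<open>v * ln v\<close> at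
  \<open>\<theta>\<close> then makes the bound affine in \<open>v\<close>.\<close>

lemma ent_sq_ge:
  assumes "E I (\<lambda>x. \<bar>d x\<bar>) \<le> M" "0 < M" "0 < \<theta>"
  shows "E I (\<lambda>x. (d x)\<^sup>2) * (ln (\<theta> / M\<^sup>2) + 1) - \<theta> \<le> ent I (\<lambda>x. (d x)\<^sup>2)"
proof -
  define v where "v = E I (\<lambda>x. (d x)\<^sup>2)"
  have v0: "v \<ge> 0" unfolding v_def by (intro E_nonneg) auto
  show ?thesis
  proof (cases "v = 0")
    case True
    have "0 \<le> (\<Prod>i\<in>I. \<mu> (x i)) * (d x)\<^sup>2" if "x \<in> I \<rightarrow>\<^sub>E A" for x
      by (intro mult_nonneg_nonneg weight_nonneg that) simp
    then have "(\<Prod>i\<in>I. \<mu> (x i)) * (d x)\<^sup>2 = 0" if "x \<in> I \<rightarrow>\<^sub>E A" "finite (I \<rightarrow>\<^sub>E A)" for x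
      using True that sum_nonneg_eq_0_iff[of "I \<rightarrow>\<^sub>E A" "\<lambda>x. (\<Prod>i\<in>I. \<mu> (x i)) * (d x)\<^sup>2"]
      unfolding v_def prod_expect_def by blast
    then have "(\<Prod>i\<in>I. \<mu> (x i)) * ((d x)\<^sup>2 * ln ((d x)\<^sup>2)) = 0"
      if "x \<in> I \<rightarrow>\<^sub>E A" "finite (I \<rightarrow>\<^sub>E A)" for x
      using that by (metis mult.assoc mult_zero_left)
    \<comment> \<open>Every weighted term vanishes on a finite cube; on an infinite one the sum is 0
      by the default value of \<open>sum\<close>.\<close>
    then have "E I (\<lambda>x. (d x)\<^sup>2 * ln ((d x)\<^sup>2)) = 0"
      unfolding prod_expect_def by (meson sum.infinite sum.neutral)
    then show ?thesis using True assms by (simp add: ent_def v_def)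
  next
    case False
    then have v: "v > 0" using v0 by simp
    \<comment> \<open>The tangent of \<open>u * ln u\<close> at \<open>v / M\<close>, multiplied by
      \<open>u = \<bar>d x\<bar>\<close> and doubled because
      \<open>ln (u\<^sup>2) = 2 * ln u\<close>. At this point of tangency the correction terms have
      the nonnegative mean \<open>v - k\<close>.\<close>
    have pt: "(d x)\<^sup>2 * ln ((d x)\<^sup>2) \<ge> 2 * ((d x)\<^sup>2 * ln (v / M) + (d x)\<^sup>2 - \<bar>d x\<bar> * (v / M))" for x
    proof -
      define u where "u = \<bar>d x\<bar>"
      have u: "(d x)\<^sup>2 = u\<^sup>2" "u \<ge> 0" by (simp_all add: u_def)
      have "u * (u * ln u) \<ge> u * (u * ln (v / M) + u - v / M)"
        using v assms u by (intro mult_left_mono mult_ln_le_tangent) auto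
      moreover have "u\<^sup>2 * ln (u\<^sup>2) = 2 * (u * (u * ln u))"
        using ln_realpow[of u 2] u by (cases "u = 0") (simp_all add: power2_eq_square)
      moreover have "2 * (u * (u * ln (v / M) + u - v / M)) = 2 * (u\<^sup>2 * ln (v / M) + u\<^sup>2 - u * (v / M))"
        by (simp add: algebra_simps power2_eq_square)
      ultimately show ?thesis unfolding u(1) u_def[symmetric] by linarith
    qed
    define e where "e = E I (\<lambda>x. (d x)\<^sup>2 * ln ((d x)\<^sup>2))"
    define k where "k = E I (\<lambda>x. \<bar>d x\<bar>) * (v / M)"
    have "e \<ge> E I (\<lambda>x. 2 * ((d x)\<^sup>2 * ln (v / M) + (d x)\<^sup>2 - \<bar>d x\<bar> * (v / M)))"
      unfolding e_def by (intro E_mono pt)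
    also have "E I (\<lambda>x. 2 * ((d x)\<^sup>2 * ln (v / M) + (d x)\<^sup>2 - \<bar>d x\<bar> * (v / M))) =
       2 * (v * ln (v / M) + v - E I (\<lambda>x. \<bar>d x\<bar>) * (v / M))"
      by (simp only: prod_expect_cmult prod_expect_add prod_expect_diff prod_expect_multc v_def[symmetric])
    finally have e: "e \<ge> 2 * (v * ln (v / M) + v - k)"
      unfolding k_def .
    have "k \<le> M * (v / M)"
      unfolding k_def using assms v by (intro mult_right_mono) auto
    then have "k \<le> v" using assms by simp
    then have "e \<ge> 2 * (v * ln (v / M))" using e by (simp add: algebra_simps)
    moreover have "v * ln v \<ge> v * ln \<theta> + v - \<theta>"
      using assms v0 by (intro mult_ln_le_tangent) auto
    moreover have "v * ln (v / M) = v * ln v - v * ln M" "v * (ln (\<theta> / M\<^sup>2) + 1) = v * ln \<theta> - 2 * (v * ln M) + v"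
      using assms v by (simp_all add: ln_div ln_realpow algebra_simps)
    ultimately show ?thesis
      unfolding ent_def v_def[symmetric] e_def[symmetric] by linarith
  qed
qed

end

section \<open>Martingale differences and a lower bound on the total influence\<close>

lemma ln_sq_le_sqrt:
  fixes y :: real
  assumes "1 \<le> y"
  shows "(ln y)\<^sup>2 \<le> 16 * sqrt y"
proof -
  \<comment> \<open>The fourth root, because squaring \<open>4 * ln q \<le> 4 * q\<close> then
    produces \<open>sqrt y\<close>.\<close>
  define q where "q = sqrt (sqrt y)"
  have q: "q \<ge> 1" using assms by (simp add: q_def)
  have "q\<^sup>2 = sqrt y" using assms by (simp add: q_def)
  then have "(q\<^sup>2)\<^sup>2 = y" using assms by simp
  then have y: "y = q ^ 4" by simp
  have "ln y = 4 * ln q" unfolding y using q by (simp add: ln_realpow)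
  moreover have "ln q \<le> q" "0 \<le> ln q" using q ln_bound[of q] by auto
  ultimately have "(ln y)\<^sup>2 \<le> (4 * q)\<^sup>2" by (intro power_mono) auto
  moreover have "q\<^sup>2 = sqrt y" using assms by (simp add: q_def)
  ultimately show ?thesis by (simp add: power_mult_distrib)
qed

context fin_dist
begin

text \<open>Conditional expectation given all coordinates but \<open>i\<close>. Iterated over the
  coordinates, the differences \<open>f - avg i f\<close> are the martingale differences of
  \<open>f\<close>.\<close>

definition avg :: "'i \<Rightarrow> (('i \<Rightarrow> 'a) \<Rightarrow> real) \<Rightarrow> ('i \<Rightarrow> 'a) \<Rightarrow> real" where
  "avg i f x = (\<Sum>c\<in>A. \<mu> c * f (x(i := c)))"

lemma E_insert_avg:
  "finite I \<Longrightarrow> i \<notin> I \<Longrightarrow> E (insert i I) f = E I (avg i f)"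
  unfolding avg_def[abs_def] by (rule prod_expect_insert')

lemma avg_upd [simp]: "avg i f (x(i := c)) = avg i f x"
  by (simp add: avg_def)

lemma avg_const: "(\<Sum>c\<in>A. \<mu> c * k) = k"
  using total by (simp flip: sum_distrib_right)

text \<open>Pythagoras: on every fibre the second moment is the variance plus the squared
  mean.\<close>

lemma E_sq_split:
  assumes "finite I" "i \<notin> I"
  shows "E (insert i I) (\<lambda>x. (h x)\<^sup>2) =
    E (insert i I) (\<lambda>x. (h x - avg i h x)\<^sup>2) + E I (\<lambda>x. (avg i h x)\<^sup>2)"
proof -
  have "avg i (\<lambda>x. (h x)\<^sup>2) x = avg i (\<lambda>x. (h x - avg i h x)\<^sup>2) x + (avg i h x)\<^sup>2" for x
  proof -
    define k where "k = avg i h x"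
    have "(\<Sum>b\<in>A. \<mu> b * (h (x(i := b)) - k)\<^sup>2) =
        (\<Sum>b\<in>A. \<mu> b * (h (x(i := b)))\<^sup>2 - 2 * k * (\<mu> b * h (x(i := b))) + \<mu> b * k\<^sup>2)"
      by (intro sum.cong refl) (simp add: power2_eq_square algebra_simps)
    also have "\<dots> = (\<Sum>b\<in>A. \<mu> b * (h (x(i := b)))\<^sup>2) - 2 * k * k + k\<^sup>2"
      by (simp only: sum.distrib sum_subtractf avg_const k_def avg_def flip: sum_distrib_left)
    finally show ?thesis unfolding k_def by (simp add: avg_def power2_eq_square)
  qed
  then have "avg i (\<lambda>x. (h x)\<^sup>2) = (\<lambda>x. avg i (\<lambda>x. (h x - avg i h x)\<^sup>2) x + (avg i h x)\<^sup>2)"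
    by (rule ext)
  then show ?thesis
    by (simp only: E_insert_avg[OF assms] prod_expect_add)
qed

text \<open>The fluctuation is an average of changes of the letter at \<open>i\<close>. Each change
  passes through the anchor \<open>a\<close> and costs two derivatives, hence the factor 2.\<close>

lemma E_abs_fluctuation_le:
  assumes "finite I" "i \<in> I" "a \<in> A"
  shows "E I (\<lambda>x. \<bar>f x - avg i f x\<bar>) \<le> 2 * (\<Sum>b\<in>A. E I (\<lambda>x. \<bar>discr a i b f x\<bar>))"
proof -
  have "\<bar>f x - avg i f x\<bar> \<le> 2 * (\<Sum>b\<in>A. \<bar>discr a i b f x\<bar>)" if x: "x \<in> I \<rightarrow>\<^sub>E A" for x
  proof -
    define R where "R = (\<Sum>b\<in>A. \<bar>discr a i b f x\<bar>)"
    have R: "\<bar>discr a i b f x\<bar> \<le> R" if "b \<in> A" for b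
      unfolding R_def using that fin by (intro member_le_sum[where f = "\<lambda>b. \<bar>discr a i b f x\<bar>"]) auto
    have xi: "x i \<in> A" using x assms by auto
    have "f x - avg i f x = (\<Sum>c\<in>A. \<mu> c * (f x - f (x(i := c))))"
      by (simp add: right_diff_distrib sum_subtractf avg_const avg_def)
    also have "\<bar>\<dots>\<bar> \<le> (\<Sum>c\<in>A. \<mu> c * (2 * R))"
    proof (intro order_trans[OF sum_abs] sum_mono)
      fix c assume c: "c \<in> A"
      have "f x - f (x(i := c)) = discr a i c f x - discr a i (x i) f x"
        by (simp add: discr_def)
      then have "\<bar>f x - f (x(i := c))\<bar> \<le> 2 * R" using R[OF c] R[OF xi] by linarith
      then show "\<bar>\<mu> c * (f x - f (x(i := c)))\<bar> \<le> \<mu> c * (2 * R)"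
        using nonneg[OF c] by (simp add: abs_mult mult_left_mono)
    qed
    also have "\<dots> = 2 * R" by (rule avg_const)
    finally show ?thesis unfolding R_def .
  qed
  then have "E I (\<lambda>x. \<bar>f x - avg i f x\<bar>) \<le> E I (\<lambda>x. 2 * (\<Sum>b\<in>A. \<bar>discr a i b f x\<bar>))"
    by (rule E_mono)
  then show ?thesis by (simp add: prod_expect_cmult prod_expect_sum)
qed

lemma discr_avg:
  assumes "i \<noteq> j"
  shows "discr a j b (avg i f) x = avg i (discr a j b f) x"
  using assms by (simp add: discr_def avg_def right_diff_distrib sum_subtractf fun_upd_twist)

text \<open>Averaging over \<open>i\<close> commutes with a derivative at \<open>j\<close> and
  contracts the L1 norm, so influence bounds survive the passage from \<open>f\<close> to
  \<open>avg i f\<close>.\<close>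

lemma E_abs_discr_avg_le:
  assumes "finite I" "i \<notin> I" "j \<in> I"
  shows "E I (\<lambda>x. \<bar>discr a j b (avg i f) x\<bar>) \<le> E (insert i I) (\<lambda>x. \<bar>discr a j b f x\<bar>)"
proof -
  have "i \<noteq> j" using assms by auto
  then have "\<bar>discr a j b (avg i f) x\<bar> \<le> avg i (\<lambda>x. \<bar>discr a j b f x\<bar>) x" for x
    unfolding discr_avg[OF \<open>i \<noteq> j\<close>] avg_def
    by (intro order_trans[OF sum_abs] sum_mono) (simp add: abs_mult nonneg abs_of_nonneg)
  then show ?thesis
    unfolding E_insert_avg[OF assms(1,2)] by (intro E_mono)
qed

text \<open>In direction \<open>i\<close> the function \<open>avg i f\<close> is constant; in every
  other direction the Pythagorean splitting applies to the derivative.\<close>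

lemma energy_split:
  assumes "finite I" "i \<notin> I"
  shows "energy a (insert i I) f = energy a (insert i I) (\<lambda>x. f x - avg i f x) + energy a I (avg i f)"
proof -
  have 1: "discr a i b (\<lambda>x. f x - avg i f x) x = discr a i b f x" for b x
    by (simp add: discr_def)
  have 2: "E (insert i I) (\<lambda>x. (discr a j b f x)\<^sup>2) =
      E (insert i I) (\<lambda>x. (discr a j b (\<lambda>x. f x - avg i f x) x)\<^sup>2) + E I (\<lambda>x. (discr a j b (avg i f) x)\<^sup>2)"
    if "j \<in> I" for j b
  proof -
    have "i \<noteq> j" using that assms by auto
    have "discr a j b (\<lambda>x. f x - avg i f x) x = discr a j b f x - discr a j b (avg i f) x" for x
      by (simp add: discr_def)
    then show ?thesis
      using E_sq_split[OF assms, of "discr a j b f"] by (simp only: discr_avg[OF \<open>i \<noteq> j\<close>])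
  qed
  show ?thesis
    using assms by (simp add: energy_def 1 2 sum.distrib)
qed

text \<open>For martingale differences \<open>d\<close> the entropy of \<open>d\<^sup>2\<close> is at most nine times the energy of \<open>d\<close>, and
  the energies add up to the energy of \<open>f\<close> (Falik and Samorodnitsky). The parameter \<open>\<theta>\<close> linearizes
  the sum of the terms \<open>v ln v\<close>; the optimal value is the average variance of the differences.\<close>

lemma variance_log_le_energy:
  fixes M \<theta> :: real
  assumes "finite I" "a \<in> A" "0 < M" "0 < \<theta>"
    and "\<And>i. i \<in> I \<Longrightarrow> 2 * (\<Sum>b\<in>A. E I (\<lambda>x. \<bar>discr a i b f x\<bar>)) \<le> M"
  shows "(E I (\<lambda>x. (f x)\<^sup>2) - (E I f)\<^sup>2) * (ln (\<theta> / M\<^sup>2) + 1) - card I * \<theta> \<le> 9 * energy a I f"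
  using assms(1,5)
proof (induction I arbitrary: f rule: finite_induct)
  case empty
  then show ?case by (simp add: energy_def)
next
  case (insert i I)
  define d where "d x = f x - avg i f x" for x
  define v where "v = E (insert i I) (\<lambda>x. (d x)\<^sup>2)"
  define L where "L = ln (\<theta> / M\<^sup>2) + 1"
  have "E (insert i I) (\<lambda>x. \<bar>d x\<bar>) \<le> M"
    unfolding d_def
    using E_abs_fluctuation_le[of "insert i I" i a f] insert.prems[of i] insert.hyps assms(2) by auto
  then have "v * L - \<theta> \<le> ent (insert i I) (\<lambda>x. (d x)\<^sup>2)"
    unfolding v_def L_def using assms by (intro ent_sq_ge)
  also have "\<dots> \<le> 9 * energy a (insert i I) d"
    using insert.hyps assms by (intro log_sobolev) auto
  finally have 1: "v * L - \<theta> \<le> 9 * energy a (insert i I) d" .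
  have 2: "(E I (\<lambda>x. (avg i f x)\<^sup>2) - (E I (avg i f))\<^sup>2) * L - card I * \<theta> \<le> 9 * energy a I (avg i f)"
    unfolding L_def
  proof (rule insert.IH)
    fix j assume j: "j \<in> I"
    have "(\<Sum>b\<in>A. E I (\<lambda>x. \<bar>discr a j b (avg i f) x\<bar>)) \<le>
        (\<Sum>b\<in>A. E (insert i I) (\<lambda>x. \<bar>discr a j b f x\<bar>))"
      by (intro sum_mono E_abs_discr_avg_le insert.hyps j)
    then show "2 * (\<Sum>b\<in>A. E I (\<lambda>x. \<bar>discr a j b (avg i f) x\<bar>)) \<le> M"
      using insert.prems[of j] j by simp
  qed
  have 3: "E (insert i I) (\<lambda>x. (f x)\<^sup>2) = v + E I (\<lambda>x. (avg i f x)\<^sup>2)"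
    unfolding v_def d_def by (rule E_sq_split[OF insert.hyps])
  have 4: "E (insert i I) f = E I (avg i f)"
    by (rule E_insert_avg[OF insert.hyps])
  have 5: "energy a (insert i I) f = energy a (insert i I) d + energy a I (avg i f)"
    unfolding d_def by (rule energy_split[OF insert.hyps])
  show ?case
    using 1 2 insert.hyps unfolding 3 4 5 L_def[symmetric] by (simp add: algebra_simps)
qed

text \<open>If the total influence were small, equality of the influences would make each of order
  \<open>ln n / n\<close>. The martingale differences would then have tiny L1 norms, which forces a
  large energy; for a monotone indicator the energy is the total influence.\<close>

lemma total_influence_ge:
  assumes I: "finite I" "2 \<le> card I" and a: "a \<in> A"
    and g: "\<And>x. x \<in> I \<rightarrow>\<^sub>E A \<Longrightarrow> g x \<in> {0, 1}"
    and mono: "\<And>x i b. x \<in> I \<rightarrow>\<^sub>E A \<Longrightarrow> i \<in> I \<Longrightarrow> b \<in> A \<Longrightarrow> 0 \<le> discr a i b g x"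
    and inv: "\<And>i. i \<in> I \<Longrightarrow> (\<Sum>b\<in>A. E I (discr a i b g)) = \<tau>"
  shows "E I g * (1 - E I g) * ln (card I) / 18 \<le> (\<Sum>b\<in>A. \<Sum>i\<in>I. E I (discr a i b g))"
proof (rule ccontr)
  assume neg: "\<not> ?thesis"
  define n where "n = real (card I)"
  define V where "V = E I g * (1 - E I g)"
  define S where "S = (\<Sum>b\<in>A. \<Sum>i\<in>I. E I (discr a i b g))"
  \<comment> \<open>Twice the bound \<open>V * ln n / (18 * n)\<close> that the negated claim gives
    for \<open>\<tau>\<close>.\<close>
  define M where "M = V * ln n / (9 * n)"
  have n: "n \<ge> 2" using I by (simp add: n_def)
  have upd: "x(i := b) \<in> I \<rightarrow>\<^sub>E A" if "x \<in> I \<rightarrow>\<^sub>E A" "i \<in> I" "b \<in> A" for x i b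
    using that by (auto simp: PiE_iff extensional_def)
  have S: "S = n * \<tau>"
    unfolding S_def by (subst sum.swap) (simp add: inv n_def)
  have "\<tau> \<ge> 0"
  proof -
    obtain i where "i \<in> I" using I by (metis card.empty not_numeral_le_zero equals0I)
    from inv[OF this, symmetric] show ?thesis
      using mono \<open>i \<in> I\<close> by (auto intro!: sum_nonneg E_nonneg)
  qed
  have lt: "S < V * ln n / 18" using neg unfolding S_def V_def n_def by simp
  have ln: "ln n > 0" using n by simp
  have "V * ln n > 0" using lt S n \<open>\<tau> \<ge> 0\<close> by (smt (verit) divide_pos_pos mult_nonneg_nonneg divide_nonpos_pos)
  then have V: "V > 0" using ln by (simp add: zero_less_mult_iff)
  have M: "M > 0" unfolding M_def using V ln n by simp
  have V4: "V \<le> 1 / 4"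
  proof -
    have "0 \<le> (E I g - 1 / 2)\<^sup>2" by simp
    then show ?thesis unfolding V_def by (simp add: power2_eq_square algebra_simps)
  qed
  \<comment> \<open>A nonnegative difference of two values in \<open>{0, 1}\<close> is its own
    square.\<close>
  have sq: "E I (\<lambda>x. (discr a i b g x)\<^sup>2) = E I (discr a i b g)" if "i \<in> I" "b \<in> A" for i b
  proof (rule prod_expect_cong)
    fix x assume x: "x \<in> I \<rightarrow>\<^sub>E A"
    show "(discr a i b g x)\<^sup>2 = discr a i b g x"
      using mono[OF x that] g[OF upd[OF x that]] g[OF upd[OF x that(1) a]]
      unfolding discr_def by auto
  qed
  have energy: "energy a I g = S"
    unfolding energy_def S_def by (subst (2) sum.swap) (intro sum.cong refl sq)
  have var: "E I (\<lambda>x. (g x)\<^sup>2) - (E I g)\<^sup>2 = V"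
  proof -
    have "E I (\<lambda>x. (g x)\<^sup>2) = E I g" using g by (intro prod_expect_cong) force
    then show ?thesis by (simp add: V_def power2_eq_square algebra_simps)
  qed
  \<comment> \<open>With \<open>\<theta> = V / n\<close> the term \<open>card I * \<theta>\<close>
    equals \<open>V\<close> and cancels the contribution of the summand 1.\<close>
  have "(E I (\<lambda>x. (g x)\<^sup>2) - (E I g)\<^sup>2) * (ln ((V / n) / M\<^sup>2) + 1) - card I * (V / n) \<le> 9 * energy a I g"
  proof (rule variance_log_le_energy[OF I(1) a M])
    show "0 < V / n" using V n by simp
    fix i assume i: "i \<in> I"
    have "(\<Sum>b\<in>A. E I (\<lambda>x. \<bar>discr a i b g x\<bar>)) = (\<Sum>b\<in>A. E I (discr a i b g))"
      using mono i by (intro sum.cong refl prod_expect_cong) auto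
    also have "\<dots> = \<tau>" by (rule inv[OF i])
    finally show "2 * (\<Sum>b\<in>A. E I (\<lambda>x. \<bar>discr a i b g x\<bar>)) \<le> M"
      using lt n unfolding S M_def by (simp add: field_simps)
  qed
  then have "V * ln ((V / n) / M\<^sup>2) \<le> 9 * S"
    unfolding var energy using n by (simp add: n_def[symmetric] algebra_simps)
  also have "\<dots> < V * (ln n / 2)" using lt by simp
  finally have "ln ((V / n) / M\<^sup>2) < ln (sqrt n)" using V n by (simp add: ln_sqrt)
  then have "(V / n) / M\<^sup>2 < sqrt n"
    using V n M by (subst (asm) ln_less_cancel_iff) auto
  moreover have "(V / n) / M\<^sup>2 = 81 * n / (V * (ln n)\<^sup>2)"
    using V n ln unfolding M_def by (simp add: power2_eq_square field_simps)
  ultimately have "81 * n / (V * (ln n)\<^sup>2) < sqrt n" by linarith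
  then have "81 * n < sqrt n * (V * (ln n)\<^sup>2)"
    using V ln by (simp add: divide_less_eq)
  \<comment> \<open>The bounds on \<open>V\<close> and \<open>(ln n)\<^sup>2\<close> turn the
    inequality into \<open>81 * n < 4 * n\<close>.\<close>
  also have "\<dots> \<le> sqrt n * (1 / 4 * (16 * sqrt n))"
    using V V4 n by (intro mult_left_mono mult_mono ln_sq_le_sqrt) auto
  also have "\<dots> = 4 * n" using n by simp
  finally show False using n by simp
qed

end

text \<open>The Russo-Margulis formula for mass moving from \<open>a\<close> to \<open>c\<close> at
  unit speed, valid on the whole line and thus also beyond the simplex. The induction is the product
  rule: the new coordinate contributes through the derivatives of its weights.\<close>

lemma has_derivative_prod_expect:
  fixes \<mu> :: "real \<Rightarrow> 'a \<Rightarrow> real"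
  assumes "finite I" and A: "finite A" "a \<in> A" "c \<in> A"
    and tot: "\<And>s. sum (\<mu> s) A = 1"
    and der: "\<And>b s. b \<in> A \<Longrightarrow>
      ((\<lambda>s. \<mu> s b) has_real_derivative of_bool (b = c) - of_bool (b = a)) (at s)"
  shows "((\<lambda>s. prod_expect A (\<mu> s) I f) has_real_derivative
     - (\<Sum>i\<in>I. prod_expect A (\<mu> s) I (discr a i c f))) (at s)"
  using assms(1)
proof (induction I arbitrary: f rule: finite_induct)
  case empty
  then show ?case by simp
next
  case (insert i I)
  define F where "F b x = f (x(i := b))" for b x
  have 1: "(\<Sum>j\<in>I. prod_expect A (\<mu> s) (insert i I) (discr a j c f)) =
     (\<Sum>b\<in>A. \<mu> s b * (\<Sum>j\<in>I. prod_expect A (\<mu> s) I (discr a j c (F b))))"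
  proof -
    have "prod_expect A (\<mu> s) I (\<lambda>x. discr a j c f (x(i := b))) = prod_expect A (\<mu> s) I (discr a j c (F b))"
      if "j \<in> I" for j b
      using that insert.hyps unfolding F_def by (intro prod_expect_cong) (metis discr_upd_commute)
    then show ?thesis
      unfolding prod_expect_insert[OF insert.hyps] sum_distrib_left
      by (subst (2) sum.swap) simp
  qed
  have 2: "prod_expect A (\<mu> s) (insert i I) (discr a i c f) =
      prod_expect A (\<mu> s) I (F a) - prod_expect A (\<mu> s) I (F c)"
    using prod_expect_insert_const[OF insert.hyps tot, of "discr a i c f"]
    by (simp add: discr_def[abs_def] F_def[abs_def] prod_expect_diff)
  have 3: "(\<Sum>b\<in>A. h b * (of_bool (b = c) - of_bool (b = a))) = h c - h a" for h :: "'a \<Rightarrow> real"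
    using A by (simp add: right_diff_distrib sum_subtractf of_bool_def if_distrib[of "\<lambda>z. _ * z"] sum.delta cong: if_cong)
  have "((\<lambda>s. \<Sum>b\<in>A. \<mu> s b * prod_expect A (\<mu> s) I (F b)) has_real_derivative
      (\<Sum>b\<in>A. (of_bool (b = c) - of_bool (b = a)) * prod_expect A (\<mu> s) I (F b) +
         - (\<Sum>j\<in>I. prod_expect A (\<mu> s) I (discr a j c (F b))) * \<mu> s b)) (at s)"
    by (intro DERIV_sum DERIV_mult der insert.IH)
  also have "(\<Sum>b\<in>A. (of_bool (b = c) - of_bool (b = a)) * prod_expect A (\<mu> s) I (F b) +
         - (\<Sum>j\<in>I. prod_expect A (\<mu> s) I (discr a j c (F b))) * \<mu> s b) =
      - (\<Sum>j\<in>insert i I. prod_expect A (\<mu> s) (insert i I) (discr a j c f))"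
    using insert.hyps by (simp add: 1 2 3 sum.distrib sum_negf sum_subtractf mult.commute)
  finally show ?case
    by (simp add: prod_expect_insert[OF insert.hyps] F_def)
qed

section \<open>Total influence of a symmetric rule\<close>

lemma prod_expect_permute:
  assumes p: "p permutes I"
  shows "prod_expect A \<mu> I (\<lambda>x. f (x \<circ> p)) = prod_expect A \<mu> I f"
  unfolding prod_expect_def
proof (rule sum.reindex_bij_witness[where i = "\<lambda>x. x \<circ> inv_into UNIV p" and j = "\<lambda>x. x \<circ> p"])
  have closed: "x \<circ> q \<in> I \<rightarrow>\<^sub>E A" if "q permutes I" "x \<in> I \<rightarrow>\<^sub>E A" for q x
    using that by (auto simp: PiE_iff extensional_def permutes_in_image)
  fix x assume x: "x \<in> I \<rightarrow>\<^sub>E A"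
  show "(x \<circ> p) \<circ> inv_into UNIV p = x" "(x \<circ> inv_into UNIV p) \<circ> p = x"
    using permutes_inv_o[OF p] by (simp_all add: comp_assoc)
  show "x \<circ> p \<in> I \<rightarrow>\<^sub>E A" "x \<circ> inv_into UNIV p \<in> I \<rightarrow>\<^sub>E A"
    using closed p permutes_inv[OF p] x by blast+
  show "(\<Prod>i\<in>I. \<mu> ((x \<circ> p) i)) * f (x \<circ> p) = (\<Prod>i\<in>I. \<mu> (x i)) * f (x \<circ> p)"
    using prod.permute[OF p, of "\<lambda>i. \<mu> (x i)"] by (simp add: o_def)
qed

text \<open>Writing a letter at \<open>i\<close> into \<open>x \<circ> p\<close> amounts to writing
  it at \<open>p i\<close> into \<open>x\<close> before composing with \<open>p\<close>.\<close>

lemma prod_expect_discr_permute: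
  assumes p: "p permutes I" and i: "i \<in> I" and ab: "a \<in> A" "b \<in> A"
    and g: "\<And>x. x \<in> I \<rightarrow>\<^sub>E A \<Longrightarrow> g (x \<circ> p) = g x"
  shows "prod_expect A \<mu> I (discr a i b g) = prod_expect A \<mu> I (discr a (p i) b g)"
proof -
  have "prod_expect A \<mu> I (discr a i b g) = prod_expect A \<mu> I (\<lambda>x. discr a i b g (x \<circ> p))"
    by (rule prod_expect_permute[OF p, symmetric])
  also have "\<dots> = prod_expect A \<mu> I (discr a (p i) b g)"
  proof (rule prod_expect_cong)
    fix x assume x: "x \<in> I \<rightarrow>\<^sub>E A"
    have "g ((x \<circ> p)(i := c)) = g (x(p i := c))" if "c \<in> A" for c
    proof -
      have "(x \<circ> p)(i := c) = x(p i := c) \<circ> p"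
        using permutes_inj[OF p] by (auto simp: fun_eq_iff inj_eq)
      moreover have "x(p i := c) \<in> I \<rightarrow>\<^sub>E A"
        using x that i p by (auto simp: PiE_iff extensional_def permutes_in_image)
      ultimately show ?thesis using g by simp
    qed
    then show "discr a i b g (x \<circ> p) = discr a (p i) b g x"
      using ab by (simp add: discr_def)
  qed
  finally show ?thesis .
qed

text \<open>Monotonicity enters through this sign: overwriting a letter by \<open>a\<close> is a
  step of \<open>le_at n a\<close>.\<close>

lemma discr_rule_nonneg:
  assumes "monotone_rule A n f" "x \<in> cube A n" "i \<in> {1..n}" "a \<in> A" "b \<in> A"
  shows "0 \<le> discr a i b (\<lambda>x. of_bool (f x = a)) x"
proof -
  have upd: "x(i := c) \<in> cube A n" if "c \<in> A" for c
    using assms that by (auto simp: PiE_iff extensional_def)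
  have "le_at n a (x(i := b)) (x(i := a))"
    by (auto simp: le_at_def)
  then have "f (x(i := b)) = a \<Longrightarrow> f (x(i := a)) = a"
    using assms(1)[unfolded monotone_rule_def, rule_format, OF assms(4) upd[OF assms(5)] upd[OF assms(4)]] by simp
  then show ?thesis by (auto simp: discr_def)
qed

text \<open>Transitivity carries every coordinate to 1, so all share the influence
  \<open>\<tau>\<close>. The letter \<open>b = a\<close> drops out because its derivative is
  identically 0.\<close>

lemma (in fin_dist) rule_influence_ge:
  assumes n: "2 \<le> n" and a: "a \<in> A"
    and sym: "symmetric_rule A n f" and mono: "monotone_rule A n f"
  defines "g \<equiv> \<lambda>x. of_bool (f x = a)"
  shows "E {1..n} g * (1 - E {1..n} g) * ln n / 18 \<le> (\<Sum>b\<in>A - {a}. \<Sum>i\<in>{1..n}. E {1..n} (discr a i b g))"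
proof -
  obtain S where S: "subgroup S (sym_group n)" "transitive_perms n S"
    "\<And>x \<sigma>. x \<in> cube A n \<Longrightarrow> \<sigma> \<in> S \<Longrightarrow> f (x \<circ> \<sigma>) = f x"
    using sym unfolding symmetric_rule_def by blast
  define \<tau> where "\<tau> = (\<Sum>b\<in>A. E {1..n} (discr a 1 b g))"
  have inv: "(\<Sum>b\<in>A. E {1..n} (discr a i b g)) = \<tau>" if i: "i \<in> {1..n}" for i
  proof -
    have "1 \<in> {1..n}" using n by simp
    then obtain \<sigma> where \<sigma>: "\<sigma> \<in> S" "\<sigma> i = 1"
      using S(2) i unfolding transitive_perms_def by blast
    have p: "\<sigma> permutes {1..n}"
      using subgroup.subset[OF S(1)] \<sigma>(1) by (auto simp: sym_group_carrier)
    have "E {1..n} (discr a i b g) = E {1..n} (discr a (\<sigma> i) b g)" if "b \<in> A" for b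
      by (intro prod_expect_discr_permute p i a that) (simp only: g_def S(3)[OF _ \<sigma>(1)])
    then show ?thesis unfolding \<tau>_def \<sigma>(2)[symmetric] by (intro sum.cong refl)
  qed
  have "E {1..n} g * (1 - E {1..n} g) * ln (card {1..n}) / 18 \<le> (\<Sum>b\<in>A. \<Sum>i\<in>{1..n}. E {1..n} (discr a i b g))"
  proof (rule total_influence_ge[OF _ _ a _ _ inv])
    show "0 \<le> discr a i b g x" if "x \<in> cube A n" "i \<in> {1..n}" "b \<in> A" for x i b
      unfolding g_def by (rule discr_rule_nonneg[OF mono that(1,2) a that(3)])
  qed (use n in \<open>auto simp: g_def\<close>)
  also have "\<dots> = (\<Sum>b\<in>A - {a}. \<Sum>i\<in>{1..n}. E {1..n} (discr a i b g))"
    using a fin by (simp add: sum.remove[OF fin a] discr_def[of a _ a, abs_def] prod_expect_def)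
  finally show ?thesis by simp
qed

section \<open>The product law as a finite sum\<close>

lemma measure_product_law:
  assumes "fin_dist A \<mu>"
  shows "measure (product_law A n \<mu>) {x \<in> cube A n. Q x} = prod_expect A \<mu> {1..n} (\<lambda>x. of_bool (Q x))"
proof -
  interpret fin_dist A \<mu> by fact
  define N where "N = point_measure A (\<lambda>a. ennreal (\<mu> a))"
  interpret N: prob_space N
    unfolding N_def using fin total nonneg
    by (intro prob_space_point_measure) (auto simp: sum_ennreal)
  interpret P: finite_product_prob_space "\<lambda>_. N" "{1..n}"
    by unfold_locales simp
  define PM where "PM = (\<Pi>\<^sub>M i\<in>{1..n}. N)"
  have sets_N: "sets N = Pow A" "space N = A" by (simp_all add: N_def sets_point_measure space_point_measure)
  have single: "measure N {b} = \<mu> b" if "b \<in> A" for b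
    using that fin nonneg[OF that]
    by (simp add: N_def measure_def emeasure_point_measure_finite)
  have eq: "{x} = (\<Pi>\<^sub>E i\<in>{1..n}. {x i})" if "x \<in> cube A n" for x
    using that PiE_singleton[of x "{1..n}"] by (simp add: PiE_def)
  have sets: "{x} \<in> sets PM" if "x \<in> cube A n" for x
    unfolding eq[OF that] PM_def using that by (intro sets_PiM_I_finite) (auto simp: sets_N)
  have meas: "measure PM {x} = (\<Prod>i\<in>{1..n}. \<mu> (x i))" if "x \<in> cube A n" for x
  proof -
    have "measure PM {x} = (\<Prod>i\<in>{1..n}. measure N {x i})"
      unfolding eq[OF that] PM_def using that by (intro P.finite_measure_PiM_emb) (auto simp: sets_N)
    also have "\<dots> = (\<Prod>i\<in>{1..n}. \<mu> (x i))"
      using that by (intro prod.cong refl single) auto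
    finally show ?thesis .
  qed
  have fin_cube: "finite (cube A n)" using fin by (intro finite_PiE) auto
  have "measure PM {x \<in> cube A n. Q x} = (\<Sum>x\<in>{x \<in> cube A n. Q x}. measure PM {x})"
    using fin_cube sets unfolding PM_def by (intro P.finite_measure_eq_sum_singleton) auto
  also have "\<dots> = (\<Sum>x\<in>{x \<in> cube A n. Q x}. \<Prod>i\<in>{1..n}. \<mu> (x i))"
    by (intro sum.cong refl meas) auto
  also have "\<dots> = prod_expect A \<mu> {1..n} (\<lambda>x. of_bool (Q x))"
    unfolding prod_expect_def using fin_cube by (simp add: of_bool_def if_distrib sum.If_cases Int_def cong: if_cong)
  finally show ?thesis unfolding PM_def N_def product_law_def .
qed

section \<open>Integration along a line\<close>

text \<open>The integrand is the derivative of \<open>ln ((1 - F) / F)\<close>.\<close>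

lemma nn_integral_window_le:
  fixes F G :: "real \<Rightarrow> real"
  assumes der: "\<And>y. (F has_real_derivative - G y) (at y)"
    and G: "\<And>y. y \<in> {0..r} \<Longrightarrow> 0 \<le> G y" "G \<in> borel_measurable borel"
    and \<epsilon>: "0 < \<epsilon>" "\<epsilon> < 1 / 2"
  shows "(\<integral>\<^sup>+y. ennreal (G y / (F y * (1 - F y))) * indicator {y \<in> {0..r}. \<epsilon> \<le> F y \<and> F y \<le> 1 - \<epsilon>} y \<partial>lborel)
    \<le> ennreal (2 * (ln (1 - \<epsilon>) - ln \<epsilon>))"
proof -
  define T where "T = {y \<in> {0..r}. \<epsilon> \<le> F y \<and> F y \<le> 1 - \<epsilon>}"
  have cont: "continuous_on S F" for S
    using der by (meson DERIV_continuous continuous_at_imp_continuous_on)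
  have [measurable]: "F \<in> borel_measurable borel"
    using cont by (rule borel_measurable_continuous_onI)
  show ?thesis
  proof (cases "T = {}")
    case True
    then show ?thesis unfolding T_def[symmetric] by simp
  next
    case False
    have anti: "F z \<le> F y" if "0 \<le> y" "y \<le> z" "z \<le> r" for y z
      using that G by (intro DERIV_nonpos_imp_nonincreasing[of y z F]) (auto intro!: exI der)
    have "T = {0..r} \<inter> F -` {\<epsilon>..1 - \<epsilon>}" by (auto simp: T_def)
    then have closed: "closed T"
      using continuous_closed_preimage[OF cont[of "{0..r}"], of "{\<epsilon>..1 - \<epsilon>}"] by simp
    have bdd: "bdd_below T" "bdd_above T" unfolding T_def by (auto intro!: bdd_belowI[of _ 0] bdd_aboveI[of _ r])
    \<comment> \<open>\<open>T\<close> is closed, so it contains its extreme points; as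
      \<open>F\<close> is nonincreasing on \<open>{0..r}\<close>, all points between them satisfy
      the window bounds. The fundamental theorem of calculus then applies on a single
      interval.\<close>
    define y1 y2 where "y1 = Inf T" and "y2 = Sup T"
    have y1: "y1 \<in> T" unfolding y1_def by (rule closed_contains_Inf[OF False bdd(1) closed])
    have y2: "y2 \<in> T" unfolding y2_def by (rule closed_contains_Sup[OF False bdd(2) closed])
    have sub: "T \<subseteq> {y1..y2}" unfolding y1_def y2_def using bdd by (auto intro: cInf_lower cSup_upper)
    have y12: "y1 \<le> y2" using y1 sub by auto
    have F: "\<epsilon> \<le> F y" "F y \<le> 1 - \<epsilon>" "0 < F y" "0 < 1 - F y" "y \<in> {0..r}" if "y \<in> {y1..y2}" for y
    proof -
      show "\<epsilon> \<le> F y" "F y \<le> 1 - \<epsilon>" "y \<in> {0..r}"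
        using anti[of y1 y] anti[of y y2] y1 y2 that unfolding T_def by auto
      then show "0 < F y" "0 < 1 - F y" using \<epsilon> by auto
    qed
    define \<Phi> where "\<Phi> y = ln (1 - F y) - ln (F y)" for y
    have "(\<integral>\<^sup>+y. ennreal (G y / (F y * (1 - F y))) * indicator T y \<partial>lborel) \<le>
        (\<integral>\<^sup>+y. ennreal (G y / (F y * (1 - F y))) * indicator {y1..y2} y \<partial>lborel)"
      using sub by (intro nn_integral_mono mult_left_mono) (auto split: split_indicator)
    also have "\<dots> = ennreal (\<Phi> y2 - \<Phi> y1)"
    proof (rule nn_integral_FTC_Icc)
      show "(\<lambda>y. G y / (F y * (1 - F y))) \<in> borel_measurable borel"
        using G(2) by measurable
      fix y assume y: "y \<in> {y1..y2}"
      have "(\<Phi> has_real_derivative (G y / (1 - F y) - (- G y) / F y)) (at y)"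
        unfolding \<Phi>_def by (auto intro!: derivative_eq_intros der F[OF y] simp: divide_inverse)
      moreover have "G y / (1 - F y) - (- G y) / F y = G y / (F y * (1 - F y))"
        using F(3,4)[OF y] by (simp add: field_simps)
      ultimately show "(\<Phi> has_real_derivative (G y / (F y * (1 - F y)))) (at y)"
        by simp
      show "0 \<le> G y / (F y * (1 - F y))"
        using F[OF y] G(1)[of y] by (intro divide_nonneg_pos mult_pos_pos) auto
    qed (rule y12)
    also have "\<dots> \<le> ennreal (2 * (ln (1 - \<epsilon>) - ln \<epsilon>))"
    proof (rule ennreal_leI)
      \<comment> \<open>On the window \<open>\<Phi>\<close> stays between
        \<open>ln \<epsilon> - ln (1 - \<epsilon>)\<close> and its negative; both ends contribute,
        hence the factor 2.\<close>
      have "\<Phi> y2 \<le> ln (1 - \<epsilon>) - ln \<epsilon>" "ln \<epsilon> - ln (1 - \<epsilon>) \<le> \<Phi> y1"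
        unfolding \<Phi>_def using F[of y1] F[of y2] y12 \<epsilon> by (auto intro!: diff_mono)
      then show "\<Phi> y2 - \<Phi> y1 \<le> 2 * (ln (1 - \<epsilon>) - ln \<epsilon>)"
        by (simp add: algebra_simps)
    qed
    finally show ?thesis unfolding T_def .
  qed
qed

section \<open>Charts of the simplex\<close>

abbreviation corner_lborel :: "'a set \<Rightarrow> 'a \<Rightarrow> ('a \<Rightarrow> real) measure" where
  "corner_lborel A b \<equiv> (\<Pi>\<^sub>M c\<in>A - {b}. lborel)"

lemma measurable_simplex_chart_inv:
  assumes "finite A" "b \<in> A"
  shows "simplex_chart_inv A b \<in> corner_lborel A b \<rightarrow>\<^sub>M (\<Pi>\<^sub>M c\<in>A. borel)"
  unfolding simplex_chart_inv_def[abs_def]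
proof (rule measurable_fun_upd[where J = "A - {b}"])
  show "A = (A - {b}) \<union> {b}" using assms by auto
  show "(\<lambda>t. t) \<in> corner_lborel A b \<rightarrow>\<^sub>M (\<Pi>\<^sub>M c\<in>A - {b}. borel)"
    by (intro measurable_ident_sets sets_PiM_cong refl) simp
  show "(\<lambda>t. 1 - sum t (A - {b})) \<in> corner_lborel A b \<rightarrow>\<^sub>M borel"
    by measurable
qed

lemma simplex_chart_inv_mem_iff:
  assumes "finite A" "b \<in> A" "t \<in> extensional (A - {b})"
  shows "simplex_chart_inv A b t \<in> prob_simplex A \<longleftrightarrow> t \<in> simplex_corner A b"
proof -
  have "sum (t(b := v)) (A - {b}) = sum t (A - {b})" for v
    by (intro sum.cong) auto
  then have "sum (simplex_chart_inv A b t) A = 1"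
    using assms by (simp add: simplex_chart_inv_def sum.remove[OF assms(1,2)])
  moreover have "simplex_chart_inv A b t \<in> extensional A"
    using assms by (auto simp: simplex_chart_inv_def extensional_def)
  ultimately show ?thesis
    using assms unfolding prob_simplex_def simplex_corner_def PiE_def
    by (auto simp: simplex_chart_inv_def)
qed

lemma sets_prob_simplex:
  assumes "finite A"
  shows "prob_simplex A \<in> sets (\<Pi>\<^sub>M c\<in>A. borel)"
proof -
  have "{\<mu> \<in> space (\<Pi>\<^sub>M c\<in>A. borel). (\<forall>a\<in>A. 0 \<le> \<mu> a) \<and> sum \<mu> A = (1::real)} \<in> sets (\<Pi>\<^sub>M c\<in>A. borel)"
    using assms by measurable
  then show ?thesis by (simp add: prob_simplex_def space_PiM)
qed

lemma fin_dist_prob_simplex: "finite A \<Longrightarrow> \<mu> \<in> prob_simplex A \<Longrightarrow> fin_dist A \<mu>"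
  by (simp add: prob_simplex_def fin_dist_def)

interpretation lborel_product: product_sigma_finite "\<lambda>_. lborel :: real measure"
  by standard

text \<open>Fubini in the chart. The fibres are the lines on which mass moves between
  \<open>a\<close> and \<open>c\<close> while all other masses stay fixed, as in the derivative
  formula.\<close>

lemma nn_integral_simplex_chart:
  assumes A: "finite A" "a \<in> A" "c \<in> A" "a \<noteq> c"
    and h: "h \<in> borel_measurable (\<Pi>\<^sub>M c\<in>A. borel)"
  shows "(\<integral>\<^sup>+t. h (simplex_chart_inv A a t) \<partial>corner_lborel A a) =
    (\<integral>\<^sup>+x. (\<integral>\<^sup>+y. h (x(c := y, a := 1 - sum x (A - {a, c}) - y)) \<partial>lborel) \<partial>(\<Pi>\<^sub>M c\<in>A - {a, c}. lborel))"
proof -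
  have J: "A - {a} = insert c (A - {a, c})" "c \<notin> A - {a, c}" "finite (A - {a, c})"
    using A by auto
  have "(\<lambda>t. h (simplex_chart_inv A a t)) \<in> borel_measurable (Pi\<^sub>M (insert c (A - {a, c})) (\<lambda>_. lborel))"
    using measurable_compose[OF measurable_simplex_chart_inv[OF A(1,2)] h] unfolding J(1) .
  then have "(\<integral>\<^sup>+t. h (simplex_chart_inv A a t) \<partial>corner_lborel A a) =
      (\<integral>\<^sup>+x. (\<integral>\<^sup>+y. h (simplex_chart_inv A a (x(c := y))) \<partial>lborel) \<partial>(\<Pi>\<^sub>M c\<in>A - {a, c}. lborel))"
    unfolding J(1) by (intro lborel_product.product_nn_integral_insert J)
  moreover have "simplex_chart_inv A a (x(c := y)) = x(c := y, a := 1 - sum x (A - {a, c}) - y)" for x y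
  proof -
    have "sum (x(c := y)) (A - {a, c}) = sum x (A - {a, c})" by (intro sum.cong) auto
    then show ?thesis using J by (simp add: simplex_chart_inv_def J(1) algebra_simps)
  qed
  ultimately show ?thesis by simp
qed

lemma measurable_two_upd:
  assumes "A = insert c (insert a J)" "x \<in> J \<rightarrow>\<^sub>E UNIV"
  shows "(\<lambda>y. x(c := y, a := r - y)) \<in> lborel \<rightarrow>\<^sub>M (\<Pi>\<^sub>M c\<in>A. (borel :: real measure))"
proof (rule measurable_PiM_single')
  show "(\<lambda>y. x(c := y, a := r - y)) \<in> space lborel \<rightarrow> (\<Pi>\<^sub>E c\<in>A. space borel)"
    using assms by (auto simp: PiE_iff extensional_def)
  fix i
  show "(\<lambda>y. (x(c := y, a := r - y)) i) \<in> borel_measurable lborel"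
    by (cases "i = a"; cases "i = c") simp_all
qed

text \<open>On each line the two charts differ by the reflection \<open>y \<mapsto> r - y\<close>.\<close>

lemma nn_integral_simplex_chart_indep:
  assumes A: "finite A" "a \<in> A" "b \<in> A"
    and h: "h \<in> borel_measurable (\<Pi>\<^sub>M c\<in>A. borel)"
  shows "(\<integral>\<^sup>+t. h (simplex_chart_inv A a t) \<partial>corner_lborel A a) =
    (\<integral>\<^sup>+t. h (simplex_chart_inv A b t) \<partial>corner_lborel A b)"
proof (cases "a = b")
  case False
  define J where "J = A - {a, b}"
  have J: "A - {b, a} = J" "A = insert b (insert a J)" using A by (auto simp: J_def)
  have "(\<integral>\<^sup>+t. h (simplex_chart_inv A a t) \<partial>corner_lborel A a) =
      (\<integral>\<^sup>+x. (\<integral>\<^sup>+y. h (x(b := y, a := 1 - sum x J - y)) \<partial>lborel) \<partial>(\<Pi>\<^sub>M c\<in>J. lborel))"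
    unfolding J_def using False by (intro nn_integral_simplex_chart A h)
  also have "\<dots> = (\<integral>\<^sup>+x. (\<integral>\<^sup>+y. h (x(a := y, b := 1 - sum x J - y)) \<partial>lborel) \<partial>(\<Pi>\<^sub>M c\<in>J. lborel))"
  proof (rule nn_integral_cong)
    fix x :: "'a \<Rightarrow> real" assume "x \<in> space (\<Pi>\<^sub>M c\<in>J. lborel)"
    then have x: "x \<in> J \<rightarrow>\<^sub>E UNIV" by (simp add: space_PiM)
    define r where "r = 1 - sum x J"
    have "(\<lambda>y. h (x(b := y, a := r - y))) \<in> borel_measurable borel"
      using measurable_compose[OF measurable_two_upd[OF J(2) x] h] by simp
    then have "(\<integral>\<^sup>+y. h (x(b := y, a := r - y)) \<partial>lborel) =
        ennreal \<bar>- 1\<bar> * (\<integral>\<^sup>+y. h (x(b := r + (- 1) * y, a := r - (r + (- 1) * y))) \<partial>lborel)"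
      by (rule nn_integral_real_affine) simp
    also have "\<dots> = (\<integral>\<^sup>+y. h (x(a := y, b := r - y)) \<partial>lborel)"
      using False by (simp add: fun_upd_twist)
    finally show "(\<integral>\<^sup>+y. h (x(b := y, a := 1 - sum x J - y)) \<partial>lborel) =
      (\<integral>\<^sup>+y. h (x(a := y, b := 1 - sum x J - y)) \<partial>lborel)" unfolding r_def .
  qed
  also have "\<dots> = (\<integral>\<^sup>+t. h (simplex_chart_inv A b t) \<partial>corner_lborel A b)"
    unfolding J(1)[symmetric] using False by (intro nn_integral_simplex_chart[symmetric] A h) auto
  finally show ?thesis .
qed simp

text \<open>The chart in the definition sits at an arbitrary point. Since integrals agree across
  charts, the volume ratio can be taken in the chart that drops \<open>a\<close>, the letter whose
  mass is traded against every other one.\<close>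

lemma measure_simplex_measure:
  assumes A: "finite A" "a \<in> A" and X: "X \<in> sets (\<Pi>\<^sub>M c\<in>A. borel)" "X \<subseteq> prob_simplex A"
  shows "measure (simplex_measure A) X =
    enn2real ((\<integral>\<^sup>+t. indicator X (simplex_chart_inv A a t) \<partial>corner_lborel A a) /
      (\<integral>\<^sup>+t. indicator (prob_simplex A) (simplex_chart_inv A a t) \<partial>corner_lborel A a))"
proof -
  define b where "b = (SOME b. b \<in> A)"
  have b: "b \<in> A" unfolding b_def using A(2) by (rule someI)
  define L where "L = corner_lborel A b"
  define ch where "ch = simplex_chart_inv A b"
  have ch: "ch \<in> L \<rightarrow>\<^sub>M (\<Pi>\<^sub>M c\<in>A. borel)"
    unfolding ch_def L_def by (rule measurable_simplex_chart_inv[OF A(1) b])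
  have vol: "emeasure L (ch -` Y \<inter> space L) =
      (\<integral>\<^sup>+t. indicator Y (simplex_chart_inv A a t) \<partial>corner_lborel A a)"
    if Y: "Y \<in> sets (\<Pi>\<^sub>M c\<in>A. borel)" for Y
  proof -
    have "emeasure L (ch -` Y \<inter> space L) = (\<integral>\<^sup>+t. indicator (ch -` Y \<inter> space L) t \<partial>L)"
      by (rule nn_integral_indicator[symmetric]) (rule measurable_sets[OF ch Y])
    also have "\<dots> = (\<integral>\<^sup>+t. indicator Y (ch t) \<partial>L)"
      by (intro nn_integral_cong) (simp split: split_indicator)
    also have "\<dots> = (\<integral>\<^sup>+t. indicator Y (simplex_chart_inv A a t) \<partial>corner_lborel A a)"
      unfolding L_def ch_def using Y by (intro nn_integral_simplex_chart_indep A b) simp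
    finally show ?thesis .
  qed
  have corner: "simplex_corner A b = ch -` prob_simplex A \<inter> space L"
  proof -
    have "t \<in> simplex_corner A b \<longleftrightarrow> ch t \<in> prob_simplex A" if "t \<in> extensional (A - {b})" for t
      unfolding ch_def using simplex_chart_inv_mem_iff[OF A(1) b that] by simp
    moreover have "simplex_corner A b \<subseteq> extensional (A - {b})"
      by (auto simp: simplex_corner_def PiE_def)
    moreover have "space L = extensional (A - {b})" by (simp add: L_def space_PiM PiE_def)
    ultimately show ?thesis by blast
  qed
  have corner_sets: "simplex_corner A b \<in> sets L"
    unfolding corner by (rule measurable_sets[OF ch sets_prob_simplex[OF A(1)]])
  have X_sets: "ch -` X \<inter> space L \<in> sets L"
    by (rule measurable_sets[OF ch X(1)])
  have ch': "ch \<in> uniform_measure L (simplex_corner A b) \<rightarrow>\<^sub>M (\<Pi>\<^sub>M c\<in>A. borel)"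
    using ch by simp
  define D where "D = distr (uniform_measure L (simplex_corner A b)) (\<Pi>\<^sub>M c\<in>A. borel) ch"
  have "simplex_measure A = restrict_space D (prob_simplex A)"
    unfolding simplex_measure_def Let_def b_def[symmetric] L_def[symmetric] ch_def[symmetric] D_def ..
  then have "measure (simplex_measure A) X = measure D X"
    using sets_prob_simplex[OF A(1)] X(2)
    by (simp add: measure_restrict_space D_def sets.Int_space_eq2[of _ "Pi\<^sub>M A (\<lambda>_. borel)"])
  also have "emeasure D X = emeasure (uniform_measure L (simplex_corner A b)) (ch -` X \<inter> space L)"
    unfolding D_def using X(1) by (subst emeasure_distr[OF ch']) simp_all
  then have "measure D X = enn2real (emeasure L (simplex_corner A b \<inter> (ch -` X \<inter> space L)) / emeasure L (simplex_corner A b))"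
    by (simp add: measure_def emeasure_uniform_measure[OF corner_sets X_sets])
  also have "simplex_corner A b \<inter> (ch -` X \<inter> space L) = ch -` X \<inter> space L"
    unfolding corner using X(2) by auto
  also have "emeasure L \<dots> = (\<integral>\<^sup>+t. indicator X (simplex_chart_inv A a t) \<partial>corner_lborel A a)"
    by (rule vol[OF X(1)])
  also have "emeasure L (simplex_corner A b) =
      (\<integral>\<^sup>+t. indicator (prob_simplex A) (simplex_chart_inv A a t) \<partial>corner_lborel A a)"
    unfolding corner by (rule vol[OF sets_prob_simplex[OF A(1)]])
  finally show ?thesis .
qed

text \<open>The corner has dimension \<open>k = card A - 1\<close> and contains the cube of side
  \<open>1 / k\<close>. This is cruder than the exact volume \<open>1 / fact k\<close>, but the
  final constant may depend on \<open>card A\<close>.\<close>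

lemma corner_volume_ge:
  assumes A: "finite A" "a \<in> A"
  shows "ennreal ((1 / real (card A - 1)) ^ (card A - 1)) \<le>
    (\<integral>\<^sup>+t. indicator (prob_simplex A) (simplex_chart_inv A a t) \<partial>corner_lborel A a)"
proof -
  define k where "k = card A - 1"
  define B where "B = (\<Pi>\<^sub>E c\<in>A - {a}. {0..1 / real k})"
  have card: "card (A - {a}) = k" using A by (simp add: k_def)
  have B: "B \<in> sets (corner_lborel A a)"
    unfolding B_def using A by (intro sets_PiM_I_finite) auto
  have "emeasure (corner_lborel A a) B = (\<Prod>c\<in>A - {a}. emeasure lborel {0..1 / real k})"
    unfolding B_def using A by (intro lborel_product.emeasure_PiM) auto
  also have "\<dots> = ennreal ((1 / real k) ^ k)"
    by (simp add: card ennreal_power)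
  finally have "ennreal ((1 / real k) ^ k) = (\<integral>\<^sup>+t. indicator B t \<partial>corner_lborel A a)"
    using B by simp
  also have "\<dots> \<le> (\<integral>\<^sup>+t. indicator (prob_simplex A) (simplex_chart_inv A a t) \<partial>corner_lborel A a)"
  proof (rule nn_integral_mono)
    fix t assume "t \<in> space (corner_lborel A a)"
    then have t: "t \<in> extensional (A - {a})" by (simp add: space_PiM PiE_def)
    have "t \<in> simplex_corner A a" if "t \<in> B"
    proof -
      have tc: "0 \<le> t c" "t c \<le> 1 / real k" if "c \<in> A - {a}" for c
        using PiE_mem[OF \<open>t \<in> B\<close>[unfolded B_def] that] by simp_all
      have "sum t (A - {a}) \<le> (\<Sum>c\<in>A - {a}. 1 / real k)" by (intro sum_mono tc)
      also have "\<dots> \<le> 1" by (simp add: card)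
      finally show ?thesis using t tc by (auto simp: simplex_corner_def PiE_def)
    qed
    then show "(indicator B t :: ennreal) \<le> indicator (prob_simplex A) (simplex_chart_inv A a t)"
      using simplex_chart_inv_mem_iff[OF A t] by (simp split: split_indicator)
  qed
  finally show ?thesis unfolding k_def .
qed

section \<open>Integration over the window\<close>

lemma measurable_prod_expect:
  assumes "finite I"
  shows "(\<lambda>\<mu>. prod_expect A \<mu> I f) \<in> borel_measurable (\<Pi>\<^sub>M c\<in>A. borel)"
  unfolding prod_expect_def
proof (intro borel_measurable_sum borel_measurable_times borel_measurable_prod borel_measurable_const)
  fix x i assume "x \<in> I \<rightarrow>\<^sub>E A" "i \<in> I"
  then show "(\<lambda>\<mu>. \<mu> (x i) :: real) \<in> borel_measurable (\<Pi>\<^sub>M c\<in>A. borel)"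
    by (intro measurable_component_singleton) auto
qed

definition window :: "'a set \<Rightarrow> 'i set \<Rightarrow> (('i \<Rightarrow> 'a) \<Rightarrow> real) \<Rightarrow> real \<Rightarrow> ('a \<Rightarrow> real) set" where
  "window A I g \<epsilon> = {\<mu> \<in> prob_simplex A. \<epsilon> \<le> prod_expect A \<mu> I g \<and> prod_expect A \<mu> I g \<le> 1 - \<epsilon>}"

lemma sets_window:
  assumes "finite A" "finite I"
  shows "window A I g \<epsilon> \<in> sets (\<Pi>\<^sub>M c\<in>A. borel)"
proof -
  note [measurable] = measurable_prod_expect[OF assms(2), of A g] sets_prob_simplex[OF assms(1)]
  have "{\<mu> \<in> space (\<Pi>\<^sub>M c\<in>A. borel). \<mu> \<in> prob_simplex A \<and> \<epsilon> \<le> prod_expect A \<mu> I g \<and> prod_expect A \<mu> I g \<le> 1 - \<epsilon>}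
      \<in> sets (\<Pi>\<^sub>M c\<in>A. borel)"
    by measurable
  also have "{\<mu> \<in> space (\<Pi>\<^sub>M c\<in>A. borel). \<mu> \<in> prob_simplex A \<and> \<epsilon> \<le> prod_expect A \<mu> I g \<and> prod_expect A \<mu> I g \<le> 1 - \<epsilon>}
      = window A I g \<epsilon>"
    by (auto simp: window_def prob_simplex_def space_PiM)
  finally show ?thesis .
qed

text \<open>Minus the derivative of \<open>prod_expect A \<mu> I g\<close> when mass moves from \<open>a\<close> to \<open>c\<close>.\<close>

definition slope :: "'a set \<Rightarrow> 'i set \<Rightarrow> (('i \<Rightarrow> 'a) \<Rightarrow> real) \<Rightarrow> 'a \<Rightarrow> 'a \<Rightarrow> ('a \<Rightarrow> real) \<Rightarrow> real" where
  "slope A I g a c \<mu> = (\<Sum>i\<in>I. prod_expect A \<mu> I (discr a i c g))"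

text \<open>Every line contributes at most the difference of logits. The lines that meet the simplex
  are parametrized by points of the unit cube \<open>Q\<close>, whose volume is 1, so the bound for
  one line is also the bound for the integral.\<close>

lemma nn_integral_slope_le:
  assumes A: "finite A" "a \<in> A" "c \<in> A" "a \<noteq> c" and I: "finite I"
    and pos: "\<And>x i. x \<in> I \<rightarrow>\<^sub>E A \<Longrightarrow> i \<in> I \<Longrightarrow> 0 \<le> discr a i c g x"
    and \<epsilon>: "0 < \<epsilon>" "\<epsilon> < 1 / 2"
  defines "P \<equiv> \<lambda>\<mu>. prod_expect A \<mu> I g"
  defines "H \<equiv> \<lambda>\<mu>. ennreal (slope A I g a c \<mu> / (P \<mu> * (1 - P \<mu>))) * indicator (window A I g \<epsilon>) \<mu>"
  shows "(\<integral>\<^sup>+t. H (simplex_chart_inv A a t) \<partial>corner_lborel A a) \<le> ennreal (2 * (ln (1 - \<epsilon>) - ln \<epsilon>))"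
    and "H \<in> borel_measurable (\<Pi>\<^sub>M c\<in>A. borel)"
proof -
  define l where "l = 2 * (ln (1 - \<epsilon>) - ln \<epsilon>)"
  have l: "l \<ge> 0" unfolding l_def using \<epsilon> by simp
  define S where "S = slope A I g a c"
  have mS: "S \<in> borel_measurable (\<Pi>\<^sub>M c\<in>A. borel)"
    unfolding S_def slope_def[abs_def] by (intro borel_measurable_sum measurable_prod_expect I)
  have mP: "P \<in> borel_measurable (\<Pi>\<^sub>M c\<in>A. borel)"
    unfolding P_def by (intro measurable_prod_expect I)
  note [measurable] = mS mP sets_window[OF A(1) I, of g \<epsilon>]
  show H: "H \<in> borel_measurable (\<Pi>\<^sub>M c\<in>A. borel)"
    unfolding H_def S_def[symmetric] by measurable
  define J where "J = A - {a, c}"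
  define Q where "Q = (\<Pi>\<^sub>E c\<in>J. {0..1::real})"
  have AJ: "A = insert c (insert a J)" "finite J" "a \<notin> J" "c \<notin> J" using A by (auto simp: J_def)
  have "(\<integral>\<^sup>+t. H (simplex_chart_inv A a t) \<partial>corner_lborel A a) =
     (\<integral>\<^sup>+x. (\<integral>\<^sup>+y. H (x(c := y, a := 1 - sum x J - y)) \<partial>lborel) \<partial>(\<Pi>\<^sub>M c\<in>J. lborel))"
    unfolding J_def by (intro nn_integral_simplex_chart A H)
  also have "\<dots> \<le> (\<integral>\<^sup>+x. ennreal l * indicator Q x \<partial>(\<Pi>\<^sub>M c\<in>J. lborel))"
  proof (rule nn_integral_mono)
    fix x :: "'a \<Rightarrow> real" assume "x \<in> space (\<Pi>\<^sub>M c\<in>J. lborel)"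
    then have x: "x \<in> J \<rightarrow>\<^sub>E UNIV" by (simp add: space_PiM)
    \<comment> \<open>The mass that \<open>a\<close> and \<open>c\<close> share on this
      line.\<close>
    define r where "r = 1 - sum x J"
    define m where "m y = x(c := y, a := r - y)" for y
    have sum_m: "sum (m y) A = 1" for y
    proof -
      have "sum (m y) J = sum x J" unfolding m_def using AJ by (intro sum.cong) auto
      then show ?thesis using AJ A(4) by (simp add: r_def) (simp add: m_def r_def)
    qed
    have m_iff: "m y \<in> prob_simplex A \<longleftrightarrow> (\<forall>j\<in>J. 0 \<le> x j) \<and> y \<in> {0..r}" for y
    proof -
      have "m y \<in> A \<rightarrow>\<^sub>E UNIV"
        using x AJ(1) by (auto simp: m_def PiE_iff extensional_def)
      moreover have "(\<forall>b\<in>A. 0 \<le> m y b) \<longleftrightarrow> (\<forall>j\<in>J. 0 \<le> x j) \<and> y \<in> {0..r}"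
        using AJ A(4) unfolding AJ(1) by (auto simp: m_def)
      ultimately show ?thesis using sum_m by (simp add: prob_simplex_def)
    qed
    show "(\<integral>\<^sup>+y. H (x(c := y, a := 1 - sum x J - y)) \<partial>lborel) \<le> ennreal l * indicator Q x"
      unfolding r_def[symmetric] m_def[symmetric]
    proof (cases "\<forall>j\<in>J. 0 \<le> x j")
      case False
      then have "H (m y) = 0" for y by (simp add: H_def window_def m_iff)
      then show "(\<integral>\<^sup>+y. H (m y) \<partial>lborel) \<le> ennreal l * indicator Q x" by simp
    next
      case nn: True
      show "(\<integral>\<^sup>+y. H (m y) \<partial>lborel) \<le> ennreal l * indicator Q x"
      proof (cases "x \<in> Q")
        case False
        \<comment> \<open>A coordinate above 1 leaves negative mass for \<open>a\<close> and
          \<open>c\<close> together, so the line misses the simplex.\<close>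
        then obtain j where j: "j \<in> J" "x j > 1"
          using nn x unfolding Q_def by (auto simp: PiE_iff not_le)
        have "x j \<le> sum x J" using nn j AJ by (intro member_le_sum) auto
        then have "r < 0" using j by (simp add: r_def)
        then have "H (m y) = 0" for y by (simp add: H_def window_def m_iff)
        then show ?thesis by simp
      next
        case True
        have H_m: "H (m y) = ennreal (S (m y) / (P (m y) * (1 - P (m y)))) *
            indicator {y \<in> {0..r}. \<epsilon> \<le> P (m y) \<and> P (m y) \<le> 1 - \<epsilon>} y" for y
          using nn by (simp add: H_def S_def window_def m_iff P_def split: split_indicator)
        have "(\<integral>\<^sup>+y. H (m y) \<partial>lborel) \<le> ennreal l"
          unfolding H_m l_def
        proof (rule nn_integral_window_le[OF _ _ _ \<epsilon>])
          show "((\<lambda>y. P (m y)) has_real_derivative - S (m y)) (at y)" for y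
            unfolding P_def S_def slope_def
            by (rule has_derivative_prod_expect[OF I A(1,2,3) sum_m])
              (use A(4) in \<open>auto simp: m_def intro!: derivative_eq_intros\<close>)
          show "0 \<le> S (m y)" if "y \<in> {0..r}" for y
          proof -
            interpret fin_dist A "m y"
              using nn that by (intro fin_dist_prob_simplex[OF A(1)]) (simp only: m_iff simp_thms)
            show ?thesis unfolding S_def slope_def by (intro sum_nonneg E_nonneg pos)
          qed
          show "(\<lambda>y. S (m y)) \<in> borel_measurable borel"
            using measurable_compose[OF measurable_two_upd[OF AJ(1) x] mS] unfolding m_def by simp
        qed
        then show ?thesis using True by simp
      qed
    qed
  qed
  also have "\<dots> = ennreal l * emeasure (\<Pi>\<^sub>M c\<in>J. lborel) Q"
    unfolding Q_def using AJ by (intro nn_integral_cmult_indicator sets_PiM_I_finite) auto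
  also have "emeasure (\<Pi>\<^sub>M c\<in>J. lborel) Q = 1"
    unfolding Q_def using AJ by (subst lborel_product.emeasure_PiM) auto
  finally show "(\<integral>\<^sup>+t. H (simplex_chart_inv A a t) \<partial>corner_lborel A a) \<le> ennreal (2 * (ln (1 - \<epsilon>) - ln \<epsilon>))"
    unfolding l_def by simp
qed

text \<open>On the window the slopes divided by \<open>P * (1 - P)\<close> add up to at least
  \<open>ln n / 18\<close>. Integrating this over the chart bounds the volume of the window by
  \<open>card A - 1\<close> integrals of the previous kind.\<close>

lemma measure_window_le:
  assumes A: "finite A" "2 \<le> card A" "a \<in> A" and n: "3 \<le> n"
    and sym: "symmetric_rule A n f" and mono: "monotone_rule A n f"
    and \<epsilon>: "0 < \<epsilon>" "\<epsilon> < 1 / 2"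
  shows "measure (simplex_measure A) (window A {1..n} (\<lambda>x. of_bool (f x = a)) \<epsilon>)
    \<le> 36 * real (card A - 1) ^ card A * (ln (1 - \<epsilon>) - ln \<epsilon>) / ln n"
proof -
  define k where "k = card A - 1"
  define l where "l = ln (1 - \<epsilon>) - ln \<epsilon>"
  define g :: "(nat \<Rightarrow> 'a) \<Rightarrow> real" where "g x = of_bool (f x = a)" for x
  define P where "P \<mu> = prod_expect A \<mu> {1..n} g" for \<mu>
  define S where "S = slope A {1..n} g a"
  define W where "W = window A {1..n} g \<epsilon>"
  define H where "H c \<mu> = ennreal (S c \<mu> / (P \<mu> * (1 - P \<mu>))) * indicator W \<mu>" for c \<mu>
  define ch where "ch = simplex_chart_inv A a"
  define vol where "vol = (\<integral>\<^sup>+t. indicator W (ch t) \<partial>corner_lborel A a)"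
  define \<kappa> where "\<kappa> = ln n / 18"
  have k: "k \<ge> 1" "card A = Suc k" using A by (auto simp: k_def)
  have l: "l \<ge> 0" unfolding l_def using \<epsilon> by simp
  have \<kappa>: "\<kappa> > 0" unfolding \<kappa>_def using n by simp
  have pos: "0 \<le> discr a i c g x" if "x \<in> cube A n" "i \<in> {1..n}" "c \<in> A" for x i c
    unfolding g_def by (rule discr_rule_nonneg[OF mono that(1,2) A(3) that(3)])
  have W: "W \<in> sets (\<Pi>\<^sub>M c\<in>A. borel)"
    unfolding W_def using A(1) by (intro sets_window) auto
  have int_H: "(\<integral>\<^sup>+t. H c (ch t) \<partial>corner_lborel A a) \<le> ennreal (2 * l)"
    and meas_H: "H c \<in> borel_measurable (\<Pi>\<^sub>M c\<in>A. borel)" if "c \<in> A - {a}" for c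
    unfolding H_def[abs_def] S_def P_def W_def l_def ch_def using that A pos \<epsilon>
    by (intro nn_integral_slope_le; auto)+
  have meas_ch: "ch \<in> corner_lborel A a \<rightarrow>\<^sub>M (\<Pi>\<^sub>M c\<in>A. borel)"
    unfolding ch_def by (rule measurable_simplex_chart_inv[OF A(1,3)])
  have pt: "ennreal \<kappa> * indicator W \<mu> \<le> (\<Sum>c\<in>A - {a}. H c \<mu>)" for \<mu>
  proof (cases "\<mu> \<in> W")
    case True
    then have \<mu>: "\<mu> \<in> prob_simplex A" and P: "\<epsilon> \<le> P \<mu>" "P \<mu> \<le> 1 - \<epsilon>"
      unfolding W_def window_def P_def by auto
    interpret fin_dist A \<mu> by (rule fin_dist_prob_simplex[OF A(1) \<mu>])
    have P': "0 < P \<mu> * (1 - P \<mu>)" using P \<epsilon> by (intro mult_pos_pos) auto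
    have S: "0 \<le> S c \<mu>" if "c \<in> A" for c
      unfolding S_def slope_def by (intro sum_nonneg E_nonneg pos that)
    have "P \<mu> * (1 - P \<mu>) * ln n / 18 \<le> (\<Sum>c\<in>A - {a}. S c \<mu>)"
      unfolding P_def S_def slope_def g_def using n by (intro rule_influence_ge A sym mono) auto
    then have "\<kappa> \<le> (\<Sum>c\<in>A - {a}. S c \<mu>) / (P \<mu> * (1 - P \<mu>))"
      using P' by (simp add: \<kappa>_def le_divide_eq mult_ac)
    also have "\<dots> = (\<Sum>c\<in>A - {a}. S c \<mu> / (P \<mu> * (1 - P \<mu>)))"
      by (rule sum_divide_distrib)
    finally have "ennreal \<kappa> \<le> ennreal (\<Sum>c\<in>A - {a}. S c \<mu> / (P \<mu> * (1 - P \<mu>)))"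
      by (rule ennreal_leI)
    also have "\<dots> = (\<Sum>c\<in>A - {a}. H c \<mu>)"
      unfolding H_def using True S P' by (subst sum_ennreal[symmetric]) auto
    finally show ?thesis using True by simp
  qed simp
  have "ennreal \<kappa> * vol = (\<integral>\<^sup>+t. ennreal \<kappa> * indicator W (ch t) \<partial>corner_lborel A a)"
    unfolding vol_def using W
    by (intro nn_integral_cmult[symmetric] measurable_compose[OF meas_ch]) simp
  also have "\<dots> \<le> (\<integral>\<^sup>+t. (\<Sum>c\<in>A - {a}. H c (ch t)) \<partial>corner_lborel A a)"
    by (intro nn_integral_mono pt)
  also have "\<dots> = (\<Sum>c\<in>A - {a}. \<integral>\<^sup>+t. H c (ch t) \<partial>corner_lborel A a)"
    by (intro nn_integral_sum measurable_compose[OF meas_ch meas_H])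
  also have "\<dots> \<le> (\<Sum>c\<in>A - {a}. ennreal (2 * l))"
    by (intro sum_mono int_H)
  also have "\<dots> = ennreal (k * (2 * l))"
    using A(1,3) l by (simp add: k_def ennreal_of_nat_eq_real_of_nat ennreal_mult' flip: ennreal_mult)
  finally have vol\<kappa>: "ennreal \<kappa> * vol \<le> ennreal (k * (2 * l))" .
  have vol: "vol \<le> ennreal (k * (2 * l) / \<kappa>)"
  \<comment> \<open>Cancelling \<open>\<kappa>\<close> requires a finite \<open>vol\<close>; as
    \<open>\<kappa>\<close> is positive, an infinite one would contradict
    \<open>vol\<kappa>\<close>.\<close>
  proof (cases vol)
    case (real v)
    then have "\<kappa> * v \<le> k * (2 * l)"
      using vol\<kappa> \<kappa> l by (simp flip: ennreal_mult)
    then have "v \<le> k * (2 * l) / \<kappa>" using \<kappa> by (simp add: le_divide_eq mult.commute)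
    then show ?thesis unfolding real(2) by (rule ennreal_leI)
  next
    case top
    then show ?thesis using vol\<kappa> \<kappa> by (simp add: ennreal_mult_top top_unique)
  qed
  have "measure (simplex_measure A) W = enn2real (vol / (\<integral>\<^sup>+t. indicator (prob_simplex A) (ch t) \<partial>corner_lborel A a))"
    unfolding vol_def ch_def using W by (intro measure_simplex_measure A) (auto simp: W_def window_def)
  also have "\<dots> \<le> k * (2 * l) / \<kappa> / (1 / real k) ^ k"
  proof (rule enn2real_leI)
    let ?corner = "\<integral>\<^sup>+t. indicator (prob_simplex A) (ch t) \<partial>corner_lborel A a"
    have ge: "ennreal ((1 / real k) ^ k) \<le> ?corner"
      unfolding ch_def by (rule corner_volume_ge[OF A(1,3), folded k_def])
    have "vol \<le> ennreal ((1 / real k) ^ k * (k * (2 * l) / \<kappa> / (1 / real k) ^ k))"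
      using vol k by simp
    also have "\<dots> = ennreal ((1 / real k) ^ k) * ennreal (k * (2 * l) / \<kappa> / (1 / real k) ^ k)"
      by (intro ennreal_mult) (use l \<kappa> in auto)
    also have "\<dots> \<le> ?corner * ennreal (k * (2 * l) / \<kappa> / (1 / real k) ^ k)"
      by (intro mult_right_mono ge) simp
    finally have "vol \<le> ?corner * ennreal (k * (2 * l) / \<kappa> / (1 / real k) ^ k)" .
    moreover have "0 < ?corner"
      by (rule less_le_trans[OF _ ge]) (use k in simp)
    ultimately show "vol / ?corner \<le> ennreal (k * (2 * l) / \<kappa> / (1 / real k) ^ k)"
      by (intro divide_le_posI_ennreal)
  qed (use l \<kappa> in simp)
  \<comment> \<open>36 is the 2 of the logit difference times the 18 of the influence bound. The
    power \<open>k ^ Suc k\<close> collects the \<open>k\<close> directions and the inverse volume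
    of the cube of side \<open>1 / k\<close>.\<close>
  also have "\<dots> = 36 * real k ^ Suc k * l / ln n"
    using k by (simp add: \<kappa>_def power_one_over)
  finally show ?thesis
    unfolding W_def g_def[abs_def] l_def by (simp add: k(2))
qed

theorem mainTheorem1:
  shows "\<exists>C :: nat \<Rightarrow> real. \<forall>A :: 'a set. finite A \<and> card A \<ge> 2 \<longrightarrow>
    (\<forall>n\<ge>3. \<forall>f \<in> cube A n \<rightarrow> A. symmetric_rule A n f \<and> monotone_rule A n f \<longrightarrow>
      (\<forall>a\<in>A. \<forall>\<epsilon>::real. 0 < \<epsilon> \<and> \<epsilon> < 1/2 \<longrightarrow>
        measure (simplex_measure A)
          {\<mu> \<in> prob_simplex A.
             \<epsilon> \<le> measure (product_law A n \<mu>) {x \<in> cube A n. f x = a} \<and>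
             measure (product_law A n \<mu>) {x \<in> cube A n. f x = a} \<le> 1 - \<epsilon>}
        \<le> C (card A) * (ln (1 - \<epsilon>) - ln \<epsilon>) * (ln (ln (real n)) / ln (real n))))"
proof (intro exI[of _ "\<lambda>k. 36 * real (k - 1) ^ k / ln (ln 3)"] allI impI ballI, elim conjE)
  fix A :: "'a set" and n f a and \<epsilon> :: real
  assume A: "finite A" "2 \<le> card A" "a \<in> A" and n: "3 \<le> n"
    and rule: "symmetric_rule A n f" "monotone_rule A n f" and \<epsilon>: "0 < \<epsilon>" "\<epsilon> < 1 / 2"
  define K where "K = 36 * real (card A - 1) ^ card A * (ln (1 - \<epsilon>) - ln \<epsilon>)"
  have K: "K \<ge> 0" unfolding K_def using \<epsilon> by simp
  \<comment> \<open>As \<open>ln 3 > 1\<close>, the number \<open>ln (ln 3)\<close> is positive and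
    at most \<open>ln (ln n)\<close>. The bound \<open>K / ln n\<close> may thus be multiplied by
    \<open>ln (ln n) / ln (ln 3)\<close>, and the denominator goes into the constant.\<close>
  have ln3: "0 < ln (ln (3 :: real))" using ln3_gt_1 by simp
  have ln_n: "ln 3 \<le> ln (real n)" using n by simp
  then have lnln: "ln (ln 3) \<le> ln (ln (real n))"
    using ln3_gt_1 by (subst ln_le_cancel_iff) auto
  have "{\<mu> \<in> prob_simplex A. \<epsilon> \<le> measure (product_law A n \<mu>) {x \<in> cube A n. f x = a} \<and>
      measure (product_law A n \<mu>) {x \<in> cube A n. f x = a} \<le> 1 - \<epsilon>} =
      window A {1..n} (\<lambda>x. of_bool (f x = a)) \<epsilon>"
    unfolding window_def
    by (intro Collect_cong conj_cong refl) (simp_all only: measure_product_law[OF fin_dist_prob_simplex[OF A(1)]])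
  moreover have "measure (simplex_measure A) (window A {1..n} (\<lambda>x. of_bool (f x = a)) \<epsilon>) \<le> K / ln n"
    unfolding K_def by (rule measure_window_le[OF A n rule \<epsilon>])
  moreover have "K / ln n * 1 \<le> K / ln n * (ln (ln n) / ln (ln 3))"
    using K ln3 lnln n by (intro mult_left_mono) auto
  ultimately show "measure (simplex_measure A)
          {\<mu> \<in> prob_simplex A.
             \<epsilon> \<le> measure (product_law A n \<mu>) {x \<in> cube A n. f x = a} \<and>
             measure (product_law A n \<mu>) {x \<in> cube A n. f x = a} \<le> 1 - \<epsilon>}
        \<le> 36 * real (card A - 1) ^ card A / ln (ln 3) * (ln (1 - \<epsilon>) - ln \<epsilon>) * (ln (ln (real n)) / ln (real n))"
    by (simp add: K_def mult_ac)
qed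

end
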